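(* Let $\Phi=\{\phi_a(x)=\frac{x+\mathfrak{p}_a}{q_a}\}_{a\in\mathcal{A}}$ be an IFS on $\mathbb{R}^d$ with $\mathfrak{p}_a\in\mathbb{Z}^d$, $q_a\in\mathbb{Z}$, $|q_a|\ge2$, satisfying the strong separation condition, and let $g:\mathbb{N}\to[0,\infty)$. Then: \begin{enumerate} \item For any $s\ge0$, if $\sum_{n=1}^\infty\sum_{\mathbf{a}\in\mathcal{A}^n}n\cdot(\mathrm{Diam}(X_{\mathbf{a}})g(n))^s<\infty$, then $\mathcal{H}^s(W^{***}_\Phi(g))=0$. \item If $g$ is non-increasing, $h_{\mathbf{p}}<-2\log\sum_{a\in\mathcal{A}}p_a^2$, and $\sum_{n=1}^\infty\sum_{\mathbf{a}\in\mathcal{A}^n}n\cdot(\mathrm{Diam}(X_{\mathbf{a}})g(n))^{\dim_S(\Phi)}=\infty$, then $\mu(W^{***}_\Phi(g))=1$. \end{enumerate}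
   Context: $X$ is the self-similar set of $\Phi$ (unique non-empty compact set with $X=\bigcup_a\phi_a(X)$), $\pi:\mathcal{A}^{\mathbb{N}}\to X$, $\pi((a_n))=\sum_{n\ge1}\mathfrak{p}_{a_n}/\prod_{l=1}^n q_{a_l}$. Strong separation: $\phi_a(X)\cap\phi_{a'}(X)=\emptyset$ for $a\ne a'$; then each $x\in X$ has a unique coding $(a_n)$ with $\pi((a_n))=x$, and for $x\in X\cap\mathbb{Q}^d$ this coding is eventually periodic. For a finite word $\mathbf{a}$, $X_{\mathbf{a}}=\phi_{a_1}\circ\cdots\circ\phi_{a_{|\mathbf{a}|}}(X)$; $\mathbf{b}^\infty$ is the periodic concatenation. Contraction ratios $r_a=1/|q_a|$; $\dim_S(\Phi)$ solves $\sum_a r_a^s=1$; $p_a=r_a^{\dim_S(\Phi)}$; $h_{\mathbf{p}}=-\sum_a p_a\log p_a$; $\mu=\pi_*\mathfrak{m}$ with $\mathfrak{m}$ the Bernoulli measure with marginal $\mathbf{p}$. For $\mathfrak{p}/q\in X\cap\mathbb{Q}^d$ with coding $(a_n)$: $q_{int}(\mathfrak{p}/q)=\inf\{\prod_{j=1}^l q_{a_j}(\prod_{j=l+1}^n q_{a_j}-1): n\in\mathbb{N},0\le l\le n-1,\ \mathfrak{p}/q=\pi(a_1\cdots a_l(a_{l+1}\cdots a_n)^\infty)\}$ and $n(\mathfrak{p}/q)=\inf\{n\in\mathbb{N}:\mathfrak{p}/q=\pi(a_1\cdots a_l(a_{l+1}\cdots a_n)^\infty)\text{ for some }0\le l\le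 n-1\}$. Define $W^{***}_\Phi(g)=\{x\in X:\|x-\mathfrak{p}/q\|<g(n(\mathfrak{p}/q))/q_{int}(\mathfrak{p}/q)\text{ for infinitely many }\mathfrak{p}/q\in X\cap\mathbb{Q}^d\}$.
   Formalization: In the definition of q_int the products are taken in absolute value: if some q_a are negative the signed infimum can be −∞, making W*** empty and part 2 false (e.g. two maps with q_a = −3, g = 1); nothing changes when all q_a ≥ 2. *)

theory Defs
  imports "HOL-Probability.Probability"
begin

text \<open>
  The alphabet is a finite type \<open>'a\<close>, the ambient space is \<open>real ^ 'd\<close>, and an IFS is given by its
  integer translations \<open>t\<close> and integer denominators \<open>q\<close>.  Sequences are indexed from \<open>0\<close>, so that
  \<open>\<omega> j\<close> is the letter written $a_{j+1}$ on paper.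
\<close>

definition ifs_map :: "('a \<Rightarrow> int ^ 'd) \<Rightarrow> ('a \<Rightarrow> int) \<Rightarrow> 'a \<Rightarrow> real ^ 'd \<Rightarrow> real ^ 'd" where
  "ifs_map t q a x = (1 / of_int (q a)) *\<^sub>R (x + (\<chi> i. of_int (t a $ i)))"

definition self_similar_set :: "('a::finite \<Rightarrow> int ^ 'd) \<Rightarrow> ('a \<Rightarrow> int) \<Rightarrow> (real ^ 'd) set" where
  "self_similar_set t q = (THE X. X \<noteq> {} \<and> compact X \<and> X = (\<Union>a. ifs_map t q a ` X))"

definition strong_separation :: "('a::finite \<Rightarrow> int ^ 'd) \<Rightarrow> ('a \<Rightarrow> int) \<Rightarrow> bool" where
  "strong_separation t q \<longleftrightarrow>
     (\<forall>a b. a \<noteq> b \<longrightarrow>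
        ifs_map t q a ` self_similar_set t q \<inter> ifs_map t q b ` self_similar_set t q = {})"

definition cylinder :: "('a::finite \<Rightarrow> int ^ 'd) \<Rightarrow> ('a \<Rightarrow> int) \<Rightarrow> 'a list \<Rightarrow> (real ^ 'd) set" where
  "cylinder t q w = foldr (ifs_map t q) w ` self_similar_set t q"

definition code_map :: "('a \<Rightarrow> int ^ 'd) \<Rightarrow> ('a \<Rightarrow> int) \<Rightarrow> (nat \<Rightarrow> 'a) \<Rightarrow> real ^ 'd" where
  "code_map t q \<omega> =
     (\<Sum>n. (1 / of_int (\<Prod>j\<le>n. q (\<omega> j))) *\<^sub>R (\<chi> i. of_int (t (\<omega> n) $ i)))"

text \<open>Meaningful for points of the self-similar set under strong separation.\<close>

definition coding :: "('a \<Rightarrow> int ^ 'd) \<Rightarrow> ('a \<Rightarrow> int) \<Rightarrow> real ^ 'd \<Rightarrow> (nat \<Rightarrow> 'a)" where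
  "coding t q x = (THE \<omega>. code_map t q \<omega> = x)"

text \<open>For \<open>l < n\<close>, the sequence $a_1 \cdots a_l (a_{l+1} \cdots a_n)^\infty$.\<close>

definition periodize :: "nat \<Rightarrow> nat \<Rightarrow> (nat \<Rightarrow> 'a) \<Rightarrow> (nat \<Rightarrow> 'a)" where
  "periodize l n \<omega> = (\<lambda>j. if j < l then \<omega> j else \<omega> (l + (j - l) mod (n - l)))"

definition rational_points :: "('a::finite \<Rightarrow> int ^ 'd) \<Rightarrow> ('a \<Rightarrow> int) \<Rightarrow> (real ^ 'd) set" where
  "rational_points t q = self_similar_set t q \<inter> {x. \<forall>i. x $ i \<in> \<rat>}"

text \<open>
  The absolute value matters only if some \<open>q a\<close> is negative: the signed products would then
  in general be unbounded below and their infimum would not be a denominator.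
\<close>

definition q_int :: "('a \<Rightarrow> int ^ 'd) \<Rightarrow> ('a \<Rightarrow> int) \<Rightarrow> real ^ 'd \<Rightarrow> real" where
  "q_int t q x = Inf {real_of_int \<bar>(\<Prod>j<l. q (coding t q x j)) * ((\<Prod>j=l..<n. q (coding t q x j)) - 1)\<bar>
     | l n. l < n \<and> x = code_map t q (periodize l n (coding t q x))}"

definition n_int :: "('a \<Rightarrow> int ^ 'd) \<Rightarrow> ('a \<Rightarrow> int) \<Rightarrow> real ^ 'd \<Rightarrow> nat" where
  "n_int t q x = Inf {n. \<exists>l<n. x = code_map t q (periodize l n (coding t q x))}"

definition W3 :: "('a::finite \<Rightarrow> int ^ 'd) \<Rightarrow> ('a \<Rightarrow> int) \<Rightarrow> (nat \<Rightarrow> real) \<Rightarrow> (real ^ 'd) set" where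
  "W3 t q g = {x \<in> self_similar_set t q.
     infinite {r \<in> rational_points t q. norm (x - r) < g (n_int t q r) / q_int t q r}}"

definition sim_dim :: "('a::finite \<Rightarrow> int) \<Rightarrow> real" where
  "sim_dim q = (THE s. (\<Sum>a\<in>UNIV. (1 / real_of_int \<bar>q a\<bar>) powr s) = 1)"

definition prob_vec :: "('a::finite \<Rightarrow> int) \<Rightarrow> 'a \<Rightarrow> real" where
  "prob_vec q a = (1 / real_of_int \<bar>q a\<bar>) powr sim_dim q"

definition prob_entropy :: "('a::finite \<Rightarrow> int) \<Rightarrow> real" where
  "prob_entropy q = - (\<Sum>a\<in>UNIV. prob_vec q a * ln (prob_vec q a))"

definition bernoulli_measure :: "('a::finite \<Rightarrow> int) \<Rightarrow> (nat \<Rightarrow> 'a) measure" where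
  "bernoulli_measure q = (\<Pi>\<^sub>M j\<in>UNIV. point_measure UNIV (\<lambda>a. ennreal (prob_vec q a)))"

definition self_similar_measure ::
    "('a::finite \<Rightarrow> int ^ 'd) \<Rightarrow> ('a \<Rightarrow> int) \<Rightarrow> (real ^ 'd) measure" where
  "self_similar_measure t q = distr (bernoulli_measure q) borel (code_map t q)"

text \<open>
  The weight of a covering set: its diameter to the power \<open>s\<close>, where the empty set has weight \<open>0\<close>
  and, for \<open>s = 0\<close>, every nonempty set has weight \<open>1\<close> (\<open>powr\<close> alone would give singletons
  weight \<open>0\<close>).
\<close>

definition hausdorff_weight :: "real \<Rightarrow> 'm::metric_space set \<Rightarrow> ennreal" where
  "hausdorff_weight s U =
     (if U = {} then 0 else if s = 0 then 1 else ennreal (diameter U powr s))"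

text \<open>Covering sets are required to be bounded because \<open>diameter\<close> is only meaningful for them.\<close>

definition hausdorff_measure :: "real \<Rightarrow> 'm::metric_space set \<Rightarrow> ennreal" where
  "hausdorff_measure s E =
     (SUP \<delta>\<in>{0<..}. INF U\<in>{U :: nat \<Rightarrow> 'm set.
        E \<subseteq> (\<Union>i. U i) \<and> (\<forall>i. bounded (U i) \<and> diameter (U i) \<le> \<delta>)}. \<Sum>i. hausdorff_weight s (U i))"

end

(* The convergence part is a covering argument: a rational point with n_int = n is coded by a word w of
   length n and a position l < n, and q_int is comparable to the product of |q| over w.

   For the divergence part, consider a random coding z under the Bernoulli measure. The point of X it codes
   is close to the rational point of z_1 ... z_l (z_(l+1) ... z_n)^infinity when the word starting at
   position n repeats the one starting at l until its p-weight falls below eps, and such a repetition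
   has probability comparable to eps. Two repetitions (l, n) and (l', n') with n - l /= n' - l' have joint
   probability at most eps^2: if the letters are revealed in a suitable order, each constraint forces a
   new letter to copy an older one. On a common diagonal the correlation decays geometrically. The second
   moment method in the blocks [8^k, 8^(k+1)), which are independent, and the second Borel-Cantelli lemma
   finish the proof. Monotonicity of g lets us ignore that (l, n) need not be the minimal representation. *)

theory Submission
  imports Defs
begin

section \<open>Events depending on finitely many letters\<close>

text \<open>Stopping by weight, not by length, is forced by unequal letter probabilities: for
  \<open>p = prob_vec q\<close> the weight of a word is its contraction ratio to the power
  \<open>sim_dim q\<close>, so one bound \<open>\<epsilon>\<close> controls both the distance to the
  rational point and the probability, for all words alike. The obstacle is that a position can be a
  source for one repetition and a copy for another. If chains of copies closed up, one constraint
  would follow from others and cost nothing. A chain alternates between a step of length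
  \<open>n - l\<close> and an opposite step of length \<open>n' - l'\<close>, so unequal gaps
  exclude this; equal gaps have overlaps that really are correlated. Origin of the numbers: with
  \<open>N = 8 ^ k\<close>, \<open>l\<close> runs through \<open>{N..<2*N}\<close> and
  \<open>n\<close> through \<open>{3*N..<4*N}\<close>, and words have at most \<open>N\<close>
  letters. Low and high blocks are then separated by \<open>3 * N\<close>, and no letter from
  \<open>5 * N\<close> on is read, for which the base 8 leaves room. There are
  \<open>N\<^sup>2 = 64 ^ k\<close> pairs, so \<open>\<epsilon>\<close> is cut off at
  \<open>1 / 64 ^ k\<close>: the expected number of repetitions is then bounded, and the second
  moment is of the order of the first.\<close>

definition determined :: "nat set \<Rightarrow> (nat \<Rightarrow> 'a) set \<Rightarrow> bool" where
  "determined V E \<longleftrightarrow> (\<forall>z z'. (\<forall>c\<in>V. z c = z' c) \<longrightarrow> z \<in> E \<longleftrightarrow> z' \<in> E)"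

lemma determined_mono: "determined V E \<Longrightarrow> V \<subseteq> W \<Longrightarrow> determined W E"
  unfolding determined_def by blast

lemma determined_Int: "determined V E \<Longrightarrow> determined V F \<Longrightarrow> determined V (E \<inter> F)"
  unfolding determined_def by blast

lemma determined_Compl: "determined V E \<Longrightarrow> determined V (- E)"
  unfolding determined_def by blast

lemma determined_UN: "(\<And>i. i \<in> I \<Longrightarrow> determined V (E i)) \<Longrightarrow> determined V (\<Union>i\<in>I. E i)"
  unfolding determined_def by blast

lemma determined_INT: "(\<And>i. i \<in> I \<Longrightarrow> determined V (E i)) \<Longrightarrow> determined V (\<Inter>i\<in>I. E i)"
  unfolding determined_def by blast

locale letter_weights =
  fixes p :: "'a::finite \<Rightarrow> real"
  assumes p_pos: "\<And>a. p a > 0" and p_sum: "(\<Sum>a\<in>UNIV. p a) = 1"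
begin

definition iid :: "(nat \<Rightarrow> 'a) measure" where
  "iid = (\<Pi>\<^sub>M j\<in>UNIV. point_measure UNIV (\<lambda>a. ennreal (p a)))"

lemma prob_space_letter: "prob_space (point_measure UNIV (\<lambda>a. ennreal (p a)))"
  by (rule prob_spaceI)
    (simp add: emeasure_point_measure_finite space_point_measure sum_ennreal p_sum less_imp_le[OF p_pos])

lemma product_prob_space_letter:
  "product_prob_space (\<lambda>_::nat. point_measure UNIV (\<lambda>a. ennreal (p a)))"
  by (rule product_prob_spaceI) (rule prob_space_letter)

sublocale iid: prob_space iid
  unfolding iid_def by (rule prob_space_PiM) (rule prob_space_letter)

lemma space_iid [simp]: "space iid = UNIV"
  by (auto simp: iid_def space_PiM space_point_measure)

lemma sets_iid_coord [measurable]: "{z. z c = a} \<in> sets iid"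
proof -
  have "(\<lambda>z. z c) -` {a} \<inter> space iid \<in> sets iid"
    unfolding iid_def
    by (rule measurable_sets[OF measurable_component_singleton]) (auto simp: sets_point_measure)
  moreover have "(\<lambda>z. z c) -` {a} \<inter> space iid = {z. z c = a}" by auto
  ultimately show ?thesis by simp
qed

lemma sets_iid_word:
  assumes "finite V" shows "{z. \<forall>c\<in>V. z c = w c} \<in> sets iid"
proof -
  have "(\<Inter>c\<in>V. {z. z c = w c}) \<in> sets iid" if "V \<noteq> {}"
    using assms that by (intro sets.finite_INT sets_iid_coord)
  moreover have "(\<Inter>c\<in>V. {z. z c = w c}) = {z. \<forall>c\<in>V. z c = w c}" by auto
  ultimately show ?thesis using sets.top[of iid] by (cases "V = {}") auto
qed

lemma prob_word:
  assumes "finite V" shows "iid.prob {z. \<forall>c\<in>V. z c = w c} = (\<Prod>c\<in>V. p (w c))"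
proof -
  interpret P: product_prob_space "\<lambda>_::nat. point_measure (UNIV::'a set) (\<lambda>a. ennreal (p a))" UNIV
    by (rule product_prob_space_letter)
  have "emeasure iid {z. \<forall>c\<in>V. z c = w c} = (\<Prod>c\<in>V. ennreal (p (w c)))"
    using P.emeasure_PiM_Collect[of V "\<lambda>c. {w c}"] assms
    by (simp add: iid_def[symmetric] sets_point_measure emeasure_point_measure_finite)
  then show ?thesis
    by (simp add: iid.emeasure_eq_measure prod_ennreal less_imp_le[OF p_pos] prod_nonneg)
qed

text \<open>\<open>E\<close> is the disjoint union of the cylinders over the words on
  \<open>V\<close> that satisfy it. A word is an extensional function, hence itself a sequence
  (\<open>undefined\<close> outside \<open>V\<close>), and since \<open>E\<close> looks at
  \<open>V\<close> only, \<open>w \<in> E\<close> tests the word.\<close>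

lemma
  assumes V: "finite V" and E: "determined V E"
  shows sets_determined: "E \<in> sets iid"
    and prob_determined: "iid.prob E = (\<Sum>w\<in>PiE V (\<lambda>_. UNIV). of_bool (w \<in> E) * (\<Prod>c\<in>V. p (w c)))"
proof -
  let ?W = "{w \<in> PiE V (\<lambda>_. UNIV). w \<in> E}"
  let ?C = "\<lambda>w. {z. \<forall>c\<in>V. z c = w c}"
  have fin: "finite (PiE V (\<lambda>_. UNIV :: 'a set))" using V by (intro finite_PiE) auto
  have eq: "E = (\<Union>w\<in>?W. ?C w)"
  proof (intro equalityI subsetI)
    fix z assume z: "z \<in> E"
    have "restrict z V \<in> E"
      using z E[unfolded determined_def, rule_format, of "restrict z V" z] by simp
    then show "z \<in> (\<Union>w\<in>?W. ?C w)" by (intro UN_I[of "restrict z V"]) auto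
  next
    fix z assume "z \<in> (\<Union>w\<in>?W. ?C w)"
    then show "z \<in> E" using E unfolding determined_def by blast
  qed
  show "E \<in> sets iid"
    by (subst eq) (use fin sets_iid_word[OF V] in \<open>intro sets.finite_UN; auto\<close>)
  have disj: "disjoint_family_on ?C ?W"
    unfolding disjoint_family_on_def
  proof (intro ballI impI)
    fix w v assume "w \<in> ?W" "v \<in> ?W" "w \<noteq> v"
    then obtain c where "c \<in> V" "w c \<noteq> v c" by (metis (no_types, lifting) PiE_ext mem_Collect_eq)
    then show "?C w \<inter> ?C v = {}" by force
  qed
  have "iid.prob E = (\<Sum>w\<in>?W. iid.prob (?C w))"
    by (subst eq, rule iid.finite_measure_finite_Union)
      (use fin sets_iid_word[OF V] disj in auto)
  also have "\<dots> = (\<Sum>w\<in>?W. \<Prod>c\<in>V. p (w c))" by (simp add: prob_word[OF V])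
  also have "\<dots> = (\<Sum>w\<in>PiE V (\<lambda>_. UNIV). of_bool (w \<in> E) * (\<Prod>c\<in>V. p (w c)))"
    using fin by (intro sum.mono_neutral_cong_left) auto
  finally show "iid.prob E = \<dots>" .
qed

lemma sum_PiE_insert:
  fixes h :: "(nat \<Rightarrow> 'a) \<Rightarrow> real"
  assumes "x \<notin> S"
  shows "(\<Sum>z\<in>PiE (insert x S) (\<lambda>_. UNIV). h z) = (\<Sum>w\<in>PiE S (\<lambda>_. UNIV). \<Sum>a\<in>UNIV. h (w(x := a)))"
proof -
  have "(\<Sum>z\<in>PiE (insert x S) (\<lambda>_. UNIV). h z)
      = (\<Sum>(a, w)\<in>UNIV \<times> PiE S (\<lambda>_. UNIV). h (w(x := a)))"
    unfolding PiE_insert_eq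
    by (subst sum.reindex) (use inj_combinator[OF assms, of "\<lambda>_. UNIV :: 'a set"] in \<open>auto simp: case_prod_unfold\<close>)
  also have "\<dots> = (\<Sum>a\<in>UNIV. \<Sum>w\<in>PiE S (\<lambda>_. UNIV). h (w(x := a)))"
    by (simp add: sum.cartesian_product)
  finally show ?thesis by (subst sum.swap) 
qed

text \<open>Words on \<open>V \<union> W\<close> are pairs of words, and the weight of a pair is a
  product: independence becomes the factorisation of a finite double sum.\<close>

lemma prob_determined_Int:
  assumes "finite V" "finite W" "V \<inter> W = {}" "determined V E" "determined W F"
  shows "iid.prob (E \<inter> F) = iid.prob E * iid.prob F"
proof -
  have ge: "(\<Sum>w\<in>PiE (V \<union> W) (\<lambda>_. UNIV). of_bool (w \<in> E \<inter> F) * (\<Prod>c\<in>V \<union> W. p (w c)))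
    = (\<Sum>w\<in>PiE V (\<lambda>_. UNIV). \<Sum>v\<in>PiE W (\<lambda>_. UNIV). of_bool (w \<in> E) * (\<Prod>c\<in>V. p (w c)) * (of_bool (v \<in> F) * (\<Prod>c\<in>W. p (v c))))"
  proof (subst sum.cartesian_product, rule sum.reindex_bij_witness[of _
       "\<lambda>(w, v) c. if c \<in> V then w c else v c" "\<lambda>z. (restrict z V, restrict z W)"])
    fix z assume z: "z \<in> PiE (V \<union> W) (\<lambda>_. UNIV :: 'a set)"
    show "(case (restrict z V, restrict z W) of (w, v) \<Rightarrow> \<lambda>c. if c \<in> V then w c else v c) = z"
      using z by (auto simp: fun_eq_iff PiE_def extensional_def)
    have "restrict z V \<in> E \<longleftrightarrow> z \<in> E" "restrict z W \<in> F \<longleftrightarrow> z \<in> F"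
      using assms(4)[unfolded determined_def, rule_format, of "restrict z V" z]
        assms(5)[unfolded determined_def, rule_format, of "restrict z W" z] by auto
    then show "(case (restrict z V, restrict z W) of (w, v) \<Rightarrow>
         of_bool (w \<in> E) * (\<Prod>c\<in>V. p (w c)) * (of_bool (v \<in> F) * (\<Prod>c\<in>W. p (v c))))
       = of_bool (z \<in> E \<inter> F) * (\<Prod>c\<in>V \<union> W. p (z c))"
      using assms(1-3) by (auto simp: prod.union_disjoint)
  next
    fix b assume b: "b \<in> PiE V (\<lambda>_. UNIV :: 'a set) \<times> PiE W (\<lambda>_. UNIV :: 'a set)"
    obtain w v where [simp]: "b = (w, v)" by force
    show "(restrict (case b of (w, v) \<Rightarrow> \<lambda>c. if c \<in> V then w c else v c) V,
        restrict (case b of (w, v) \<Rightarrow> \<lambda>c. if c \<in> V then w c else v c) W) = b"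
      using b assms(3) by (auto simp: fun_eq_iff PiE_def extensional_def restrict_def)
    show "(case b of (w, v) \<Rightarrow> \<lambda>c. if c \<in> V then w c else v c) \<in> PiE (V \<union> W) (\<lambda>_. UNIV)"
      using b by (auto simp: PiE_def extensional_def)
  qed auto
  have "determined (V \<union> W) (E \<inter> F)"
    using assms by (auto intro!: determined_Int intro: determined_mono)
  then have "iid.prob (E \<inter> F) = (\<Sum>w\<in>PiE (V \<union> W) (\<lambda>_. UNIV). of_bool (w \<in> E \<inter> F) * (\<Prod>c\<in>V \<union> W. p (w c)))"
    using assms by (intro prob_determined) auto
  also note ge
  finally show ?thesis
    by (simp only: prob_determined[OF assms(1,4)] prob_determined[OF assms(2,5)] sum_product)
qed

lemma prob_INT_determined:
  assumes "finite K" "\<And>k. finite (V k)" "\<And>k j. k \<noteq> j \<Longrightarrow> V k \<inter> V j = {}" "\<And>k. determined (V k) (E k)"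
  shows "iid.prob (\<Inter>k\<in>K. E k) = (\<Prod>k\<in>K. iid.prob (E k))"
  using assms(1)
proof induction
  case empty
  then show ?case using iid.prob_space by simp
next
  case (insert x K)
  have "iid.prob (E x \<inter> (\<Inter>k\<in>K. E k)) = iid.prob (E x) * iid.prob (\<Inter>k\<in>K. E k)"
  proof (rule prob_determined_Int[of "V x" "\<Union>k\<in>K. V k"])
    show "determined (\<Union>k\<in>K. V k) (\<Inter>k\<in>K. E k)"
      using assms(4) by (intro determined_INT) (auto intro: determined_mono)
    have "V x \<inter> V k = {}" if "k \<in> K" for k using that insert(2) by (intro assms(3)) auto
    then show "V x \<inter> (\<Union>k\<in>K. V k) = {}" by blast
  qed (use assms(2,4) insert(1) in auto)
  then show ?case using insert by simp
qed

text \<open>The second Borel-Cantelli lemma: \<open>1 - x \<le> exp (- x)\<close> turns the product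
  of the complementary probabilities into the exponential of minus a divergent partial sum.\<close>

lemma borel_cantelli_determined:
  fixes E :: "nat \<Rightarrow> (nat \<Rightarrow> 'a) set"
  assumes V: "\<And>k. finite (V k)" "\<And>k j. k \<noteq> j \<Longrightarrow> V k \<inter> V j = {}" "\<And>k. determined (V k) (E k)"
    and div: "\<not> summable (\<lambda>k. iid.prob (E k))"
  shows "AE z in iid. infinite {k. z \<in> E k}"
proof -
  have [measurable]: "E k \<in> sets iid" for k using V by (intro sets_determined)
  have null: "iid.prob (\<Inter>k\<in>{M..}. - E k) = 0" for M
  proof -
    have meas: "(\<Inter>k\<in>{M..}. - E k) \<in> sets iid"
      by (rule sets.countable_INT') (auto simp: Compl_eq_Diff_UNIV simp flip: space_iid)
    have bd: "iid.prob (\<Inter>k\<in>{M..}. - E k) \<le> exp (- (\<Sum>k=M..<n. iid.prob (E k)))" for n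
    proof -
      have "iid.prob (\<Inter>k\<in>{M..}. - E k) \<le> iid.prob (\<Inter>k\<in>{M..<n}. - E k)"
        by (rule iid.finite_measure_mono)
          (auto intro!: sets_determined[of "\<Union>k\<in>{M..<n}. V k"] determined_INT
             determined_mono[OF determined_Compl] V)
      also have "\<dots> = (\<Prod>k\<in>{M..<n}. iid.prob (- E k))"
        by (intro prob_INT_determined[of _ V] V determined_Compl) auto
      also have "\<dots> \<le> (\<Prod>k\<in>{M..<n}. exp (- iid.prob (E k)))"
      proof (intro prod_mono conjI)
        fix k
        have "iid.prob (- E k) = 1 - iid.prob (E k)"
          using iid.prob_compl[of "E k"] by (simp add: Compl_eq_Diff_UNIV)
        also have "\<dots> \<le> exp (- iid.prob (E k))" using exp_ge_add_one_self[of "- iid.prob (E k)"] by simp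
        finally show "iid.prob (- E k) \<le> \<dots>" .
      qed auto
      also have "\<dots> = exp (- (\<Sum>k=M..<n. iid.prob (E k)))" by (simp add: exp_sum sum_negf[symmetric])
      finally show ?thesis .
    qed
    \<comment> \<open>Otherwise the partial sums would stay below a constant minus
      \<open>ln e\<close>, against divergence.\<close>
    have "\<exists>n. exp (- (\<Sum>k=M..<n. iid.prob (E k))) < e" if "e > 0" for e
    proof (rule ccontr)
      assume H: "\<nexists>n. exp (- (\<Sum>k=M..<n. iid.prob (E k))) < e"
      have "summable (\<lambda>k. iid.prob (E k))"
      proof (rule bounded_imp_summable)
        fix n
        have "e \<le> exp (- (\<Sum>k=M..<Suc n. iid.prob (E k)))" using H by (meson not_le)
        then have "(\<Sum>k=M..<Suc n. iid.prob (E k)) \<le> - ln e"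
          using that ln_ge_iff[of e "- (\<Sum>k=M..<Suc n. iid.prob (E k))"] ln_le_cancel_iff[of e "exp (- (\<Sum>k=M..<Suc n. iid.prob (E k)))"] by (simp del: sum.op_ivl_Suc)
        moreover have "(\<Sum>k\<le>n. iid.prob (E k)) \<le> (\<Sum>k\<in>{..<M} \<union> {M..<Suc n}. iid.prob (E k))"
          by (rule sum_mono2) auto
        moreover have "\<dots> = (\<Sum>k<M. iid.prob (E k)) + (\<Sum>k=M..<Suc n. iid.prob (E k))"
          by (rule sum.union_disjoint) auto
        ultimately show "(\<Sum>k\<le>n. iid.prob (E k)) \<le> (\<Sum>k<M. iid.prob (E k)) - ln e" by linarith
      qed auto
      then show False using div by blast
    qed
    then have "iid.prob (\<Inter>k\<in>{M..}. - E k) \<le> 0"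
      using bd leD not_le by blast
    then show ?thesis by (simp add: order_antisym)
  qed
  have "AE z in iid. \<forall>M. z \<notin> (\<Inter>k\<in>{M..}. - E k)"
  proof (subst AE_all_countable, intro allI)
    fix M
    have "(\<Inter>k\<in>{M..}. - E k) \<in> null_sets iid"
      using null[of M]
      by (auto simp: null_sets_def iid.emeasure_eq_measure Compl_eq_Diff_UNIV simp flip: space_iid
          intro!: sets.countable_INT')
    then show "AE z in iid. z \<notin> (\<Inter>k\<in>{M..}. - E k)" by (rule AE_not_in)
  qed
  then show ?thesis
    by (rule AE_mp) (auto intro!: AE_I2 simp: infinite_nat_iff_unbounded_le)
qed

section \<open>Comparison of the Bernoulli measure with a copying process\<close>

text \<open>Letters are revealed in the order \<open>\<tau>\<close>; the letter at \<open>c\<close> is either free or, if \<open>act c\<close> holds (which may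
  depend on the past), a copy of the letter at \<open>s c\<close>. The summand is the law of this process.\<close>

lemma copy_weight_sum:
  fixes \<tau> :: "nat \<Rightarrow> nat" and act :: "nat \<Rightarrow> (nat \<Rightarrow> 'a) \<Rightarrow> bool" and s :: "nat \<Rightarrow> nat"
  assumes "finite V" "inj_on \<tau> V"
    and "\<And>c z z'. c \<in> V \<Longrightarrow> (\<And>c'. c' \<in> V \<Longrightarrow> \<tau> c' < \<tau> c \<Longrightarrow> z c' = z' c') \<Longrightarrow> act c z = act c z'"
    and "\<And>c z. c \<in> V \<Longrightarrow> act c z \<Longrightarrow> s c \<in> V \<and> \<tau> (s c) < \<tau> c"
  shows "(\<Sum>z\<in>PiE V (\<lambda>_. UNIV). \<Prod>c\<in>V. if act c z then of_bool (z c = z (s c)) else p (z c)) = 1"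
  using assms
proof (induction V rule: finite_ranking_induct[where f = \<tau>])
  case empty
  show ?case by simp
next
  case (insert x S)
  show ?case
  \<comment> \<open>The ranking induction also covers an \<open>x\<close> that already lies in
    \<open>S\<close>; the set is then unchanged.\<close>
  proof (cases "x \<in> S")
    case True
    then have eq: "insert x S = S" by auto
    show ?thesis unfolding eq
    proof (rule insert(3))
      show "inj_on \<tau> S" using insert(4) eq by simp
      show "act c z = act c z'" if "c \<in> S" "\<And>c'. c' \<in> S \<Longrightarrow> \<tau> c' < \<tau> c \<Longrightarrow> z c' = z' c'" for c z z'
        by (rule insert(5)) (use that eq in auto)
      show "s c \<in> S \<and> \<tau> (s c) < \<tau> c" if "c \<in> S" "act c z" for c z
        using insert(6)[of c z] that eq by simp
    qed
  next
    case False
    let ?h = "\<lambda>z c. if act c z then of_bool (z c = z (s c)) else p (z c)"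
    have less: "\<tau> y < \<tau> x" if "y \<in> S" for y
    proof -
      have "y \<noteq> x" using that False by auto
      then have "\<tau> y \<noteq> \<tau> x" using inj_onD[OF insert(4), of y x] that by auto
      then show ?thesis using insert(2)[OF that] by simp
    qed
    have act_S: "act c z = act c z'"
      if "c \<in> S" "\<And>c'. c' \<in> S \<Longrightarrow> \<tau> c' < \<tau> c \<Longrightarrow> z c' = z' c'" for c z z'
    proof (rule insert(5))
      show "c \<in> insert x S" using that(1) by simp
      fix c' assume "c' \<in> insert x S" "\<tau> c' < \<tau> c"
      then show "z c' = z' c'" using that less[of c] by (cases "c' = x") auto
    qed
    have src: "s c \<in> S \<and> \<tau> (s c) < \<tau> c" if "c \<in> S" "act c z" for c z
      using insert(6)[of c z] that less[of c] by auto
    have IH: "(\<Sum>z\<in>PiE S (\<lambda>_. UNIV). \<Prod>c\<in>S. ?h z c) = 1"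
    proof (rule insert(3))
      show "inj_on \<tau> S" using insert(4) by (rule inj_on_subset) auto
    qed (fact act_S, fact src)
    have step: "?h (w(x := a)) c = ?h w c" if "c \<in> S" for w a c
    proof -
      have "act c (w(x := a)) = act c w" using False that by (intro act_S) auto
      moreover have "(w(x := a)) c = w c" using False that by auto
      moreover have "(w(x := a)) (s c) = w (s c)" if "act c w"
        using src[OF \<open>c \<in> S\<close> that] False by auto
      ultimately show ?thesis by auto
    qed
    \<comment> \<open>The letter at \<open>x\<close> comes last, so it can be summed out alone: a
      copy has exactly one admissible value, and a free letter has total mass 1 by
      \<open>p_sum\<close>.\<close>
    have last: "(\<Sum>a\<in>UNIV. ?h (w(x := a)) x) = 1" for w
    proof -
      have act_x: "act x (w(x := a)) = act x w" for a by (rule insert(5)) auto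
      show ?thesis
      proof (cases "act x w")
        case True
        then have "s x \<noteq> x" using insert(6)[of x w] by auto
        then show ?thesis using True by (simp add: act_x of_bool_def)
      qed (simp add: act_x p_sum)
    qed
    have "(\<Sum>z\<in>PiE (insert x S) (\<lambda>_. UNIV). \<Prod>c\<in>insert x S. ?h z c)
      = (\<Sum>w\<in>PiE S (\<lambda>_. UNIV). \<Sum>a\<in>UNIV. ?h (w(x := a)) x * (\<Prod>c\<in>S. ?h w c))"
    proof (subst sum_PiE_insert[OF False], intro sum.cong refl)
      fix w a
      have "(\<Prod>c\<in>insert x S. ?h (w(x := a)) c) = ?h (w(x := a)) x * (\<Prod>c\<in>S. ?h (w(x := a)) c)"
        using insert(1) False by (rule prod.insert)
      also have "(\<Prod>c\<in>S. ?h (w(x := a)) c) = (\<Prod>c\<in>S. ?h w c)" by (intro prod.cong refl step)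
      finally show "(\<Prod>c\<in>insert x S. ?h (w(x := a)) c) = ?h (w(x := a)) x * (\<Prod>c\<in>S. ?h w c)" .
    qed
    also have "\<dots> = 1" by (simp only: sum_distrib_right[symmetric] last IH mult_1)
    finally show ?thesis .
  qed
qed

text \<open>A change of law. On words that obey the copying rule, the Bernoulli weight is the weight
  under the copying process times the product of \<open>p\<close> over the copied positions. The
  copying process has total mass 1, so a uniform bound on that product is a bound on the
  probability. For the upper bound every point of \<open>E\<close> must obey the rule; for the lower
  bound every point that obeys it must lie in \<open>E\<close>.\<close>

lemma
  fixes \<tau> :: "nat \<Rightarrow> nat" and act :: "nat \<Rightarrow> (nat \<Rightarrow> 'a) \<Rightarrow> bool" and s :: "nat \<Rightarrow> nat"
  assumes V: "finite V" "inj_on \<tau> V"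
    and act: "\<And>c z z'. c \<in> V \<Longrightarrow> (\<And>c'. c' \<in> V \<Longrightarrow> \<tau> c' < \<tau> c \<Longrightarrow> z c' = z' c') \<Longrightarrow> act c z = act c z'"
    and src: "\<And>c z. c \<in> V \<Longrightarrow> act c z \<Longrightarrow> s c \<in> V \<and> \<tau> (s c) < \<tau> c"
    and E: "determined V E"
  shows prob_copy_le: "K \<ge> 0 \<Longrightarrow> (\<And>z. z \<in> E \<Longrightarrow> (\<forall>c\<in>V. act c z \<longrightarrow> z c = z (s c)) \<and> (\<Prod>c\<in>{c \<in> V. act c z}. p (z c)) \<le> K) \<Longrightarrow> iid.prob E \<le> K"
    and prob_copy_ge: "(\<And>z. (\<forall>c\<in>V. act c z \<longrightarrow> z c = z (s c)) \<Longrightarrow> z \<in> E \<and> (\<Prod>c\<in>{c \<in> V. act c z}. p (z c)) \<ge> K) \<Longrightarrow> iid.prob E \<ge> K"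
proof -
  let ?h = "\<lambda>z. \<Prod>c\<in>V. if act c z then of_bool (z c = z (s c)) else p (z c)"
  have one: "(\<Sum>z\<in>PiE V (\<lambda>_. UNIV). ?h z) = 1" by (rule copy_weight_sum[OF V act src])
  have P: "iid.prob E = (\<Sum>w\<in>PiE V (\<lambda>_. UNIV). of_bool (w \<in> E) * (\<Prod>c\<in>V. p (w c)))"
    by (rule prob_determined[OF V(1) E])
  have nonneg: "?h z \<ge> 0" for z by (intro prod_nonneg) (auto simp: less_imp_le[OF p_pos])
  have split: "(\<Prod>c\<in>V. p (z c)) = (\<Prod>c\<in>{c \<in> V. act c z}. p (z c)) * ?h z"
    if "\<forall>c\<in>V. act c z \<longrightarrow> z c = z (s c)" for z
  proof -
    have "?h z = (\<Prod>c\<in>V. if act c z then 1 else p (z c))"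
      using that by (intro prod.cong) auto
    moreover have "(\<Prod>c\<in>{c \<in> V. act c z}. p (z c)) = (\<Prod>c\<in>V. if act c z then p (z c) else 1)"
      using V(1) by (simp add: prod.inter_filter)
    moreover have "(\<Prod>c\<in>V. p (z c)) = (\<Prod>c\<in>V. (if act c z then p (z c) else 1) * (if act c z then 1 else p (z c)))"
      by (intro prod.cong) auto
    ultimately show ?thesis by (simp add: prod.distrib)
  qed
  {
    assume "0 \<le> K" and H: "\<And>z. z \<in> E \<Longrightarrow> (\<forall>c\<in>V. act c z \<longrightarrow> z c = z (s c)) \<and> (\<Prod>c\<in>{c \<in> V. act c z}. p (z c)) \<le> K"
      have "iid.prob E \<le> (\<Sum>w\<in>PiE V (\<lambda>_. UNIV). K * ?h w)"
        unfolding P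
      proof (rule sum_mono)
        fix w
        show "of_bool (w \<in> E) * (\<Prod>c\<in>V. p (w c)) \<le> K * ?h w"
        proof (cases "w \<in> E")
          case True
          then have "(\<Prod>c\<in>{c \<in> V. act c w}. p (w c)) * ?h w \<le> K * ?h w"
            using H[of w] nonneg by (intro mult_right_mono) auto
          moreover have "(\<Prod>c\<in>V. p (w c)) = (\<Prod>c\<in>{c \<in> V. act c w}. p (w c)) * ?h w"
            using H[OF True] by (intro split) auto
          ultimately show ?thesis using True by (simp only: of_bool_eq mult_1)
        qed (use nonneg \<open>0 \<le> K\<close> in auto)
      qed
      also have "\<dots> = K" by (simp only: sum_distrib_left[symmetric] one mult_1_right)
      finally show "iid.prob E \<le> K" .
  }
  {
    assume H: "\<And>z. (\<forall>c\<in>V. act c z \<longrightarrow> z c = z (s c)) \<Longrightarrow> z \<in> E \<and> (\<Prod>c\<in>{c \<in> V. act c z}. p (z c)) \<ge> K"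
    have "K = (\<Sum>w\<in>PiE V (\<lambda>_. UNIV). K * ?h w)" by (simp only: sum_distrib_left[symmetric] one mult_1_right)
    also have "\<dots> \<le> iid.prob E" unfolding P
    proof (rule sum_mono)
      fix w
      show "K * ?h w \<le> of_bool (w \<in> E) * (\<Prod>c\<in>V. p (w c))"
      proof (cases "\<forall>c\<in>V. act c w \<longrightarrow> w c = w (s c)")
        case True
        then have "K * ?h w \<le> (\<Prod>c\<in>{c \<in> V. act c w}. p (w c)) * ?h w"
          using H[of w] nonneg by (intro mult_right_mono) auto
        moreover have "w \<in> E" using H[OF True] by auto
        ultimately show ?thesis using split[OF True] by (simp only: of_bool_eq mult_1)
      next
        case False
        then have "?h w = 0" using V(1) by (auto simp: prod_zero_iff)
        then show ?thesis by (simp add: prod_nonneg less_imp_le[OF p_pos])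
      qed
    qed
    finally show "iid.prob E \<ge> K" .
  }
qed

end

section \<open>Repetitions in random words\<close>

text \<open>With \<open>Z\<close> the number of events that occur,
  \<open>2 * c * Z - (c * Z)\<^sup>2\<close> is at most the indicator of \<open>Z > 0\<close>,
  because \<open>(1 - c * Z)\<^sup>2 \<ge> 0\<close>. The best \<open>c\<close> gives
  \<open>(E Z)\<^sup>2 / E (Z\<^sup>2)\<close>; keeping \<open>c\<close> free avoids the division
  and asks only for one-sided bounds on the two sums.\<close>

lemma (in prob_space) prob_UN_ge_second_moment:
  assumes "finite I" and [measurable]: "\<And>i. i \<in> I \<Longrightarrow> A i \<in> events"
  shows "prob (\<Union>i\<in>I. A i) \<ge> 2 * c * (\<Sum>i\<in>I. prob (A i)) - c\<^sup>2 * (\<Sum>i\<in>I. \<Sum>j\<in>I. prob (A i \<inter> A j))"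
proof -
  have AI [measurable]: "A i \<inter> A j \<in> events" if "i \<in> I" "j \<in> I" for i j using that assms(2) by auto
  have UA [measurable]: "(\<Union>i\<in>I. A i) \<in> events" using assms by auto
  let ?f = "\<lambda>x. 2 * c * (\<Sum>i\<in>I. indicat_real (A i) x) - c\<^sup>2 * (\<Sum>i\<in>I. \<Sum>j\<in>I. indicat_real (A i \<inter> A j) x)"
  have "2 * c * (\<Sum>i\<in>I. prob (A i)) - c\<^sup>2 * (\<Sum>i\<in>I. \<Sum>j\<in>I. prob (A i \<inter> A j)) = expectation ?f"
    using assms AI by (simp add: Bochner_Integration.integral_sum integrable_sum less_top[symmetric])
  also have "\<dots> \<le> expectation (indicat_real (\<Union>i\<in>I. A i))"
  proof (rule integral_mono)
    show "integrable M ?f" using assms AI by (auto simp: less_top[symmetric])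
    show "integrable M (indicat_real (\<Union>i\<in>I. A i))" using UA by (simp add: less_top[symmetric])
    fix x
    let ?Z = "\<Sum>i\<in>I. indicat_real (A i) x"
    have f: "?f x = 2 * c * ?Z - (c * ?Z)\<^sup>2"
      by (simp add: indicator_inter_arith power2_eq_square sum_product mult_ac sum_distrib_left)
    show "?f x \<le> indicat_real (\<Union>i\<in>I. A i) x"
    proof (cases "x \<in> (\<Union>i\<in>I. A i)")
      case True
      have "0 \<le> (1 - c * ?Z)\<^sup>2" by simp
      then show ?thesis using True unfolding f by (simp add: power2_eq_square algebra_simps)
    next
      case False
      then have "?Z = 0" by (intro sum.neutral) auto
      then show ?thesis unfolding f using False by simp
    qed
  qed
  also have "\<dots> = prob (\<Union>i\<in>I. A i)" using UA by simp
  finally show ?thesis .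
qed

text \<open>On each side of \<open>i\<close> the distances are distinct, so each half is dominated
  by a full geometric series. This bounds the correlations along one diagonal.\<close>

lemma sum_geometric_dist_le:
  fixes r :: real
  assumes "0 \<le> r" "r < 1" "finite I"
  shows "(\<Sum>j\<in>I. r ^ nat \<bar>int i - int j\<bar>) \<le> 2 / (1 - r)"
proof -
  have fin: "finite {j \<in> I. j \<le> i}" "finite {j \<in> I. i < j}" using assms by auto
  have geo: "(\<Sum>j\<in>J. r ^ h j) \<le> 1 / (1 - r)" if "finite J" "inj_on h J" for J :: "nat set" and h
  proof -
    have "(\<Sum>j\<in>J. r ^ h j) = (\<Sum>k\<in>h ` J. r ^ k)" using that by (simp add: sum.reindex)
    also have "\<dots> \<le> (\<Sum>k. r ^ k)" using assms that by (intro sum_le_suminf summable_geometric) auto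
    also have "\<dots> = 1 / (1 - r)" using assms by (intro suminf_geometric) auto
    finally show ?thesis .
  qed
  have "(\<Sum>j\<in>I. r ^ nat \<bar>int i - int j\<bar>) = (\<Sum>j\<in>{j \<in> I. j \<le> i} \<union> {j \<in> I. i < j}. r ^ nat \<bar>int i - int j\<bar>)"
    by (intro sum.cong) auto
  also have "\<dots> = (\<Sum>j\<in>{j \<in> I. j \<le> i}. r ^ nat \<bar>int i - int j\<bar>) + (\<Sum>j\<in>{j \<in> I. i < j}. r ^ nat \<bar>int i - int j\<bar>)"
    using fin by (intro sum.union_disjoint) auto
  also have "\<dots> \<le> 1 / (1 - r) + 1 / (1 - r)"
    using fin by (intro add_mono geo) (auto simp: inj_on_def)
  finally show ?thesis by simp
qed

lemma prod_le_prod_subset: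
  fixes f :: "'b \<Rightarrow> real"
  assumes "finite V" "A \<subseteq> V" "\<And>x. x \<in> V \<Longrightarrow> 0 \<le> f x" "\<And>x. x \<in> V \<Longrightarrow> f x \<le> 1"
  shows "prod f V \<le> prod f A"
proof -
  have "prod f V = prod f (V - A) * prod f A" using assms by (intro prod.subset_diff)
  also have "\<dots> \<le> 1 * prod f A"
    using assms by (intro mult_right_mono prod_le_1 prod_nonneg) auto
  finally show ?thesis by simp
qed

section \<open>Repetitions, their probabilities and their correlations\<close>

context letter_weights
begin

text \<open>For \<open>p = prob_vec q\<close> this is the contraction ratio of the word at
  \<open>i\<close>, raised to the power \<open>sim_dim q\<close>; a bound on it is a bound on a
  distance.\<close>

definition wt :: "(nat \<Rightarrow> 'a) \<Rightarrow> nat \<Rightarrow> nat \<Rightarrow> real" where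
  "wt z i m = (\<Prod>a<m. p (z (i + a)))"

text \<open>The length \<open>m\<close> is free and the weight decides, which makes the
  probabilities comparable for all letters. The cap \<open>L\<close> makes the event depend on
  finitely many letters. The two blocks may overlap.\<close>

definition repetition :: "nat \<Rightarrow> real \<Rightarrow> nat \<Rightarrow> nat \<Rightarrow> (nat \<Rightarrow> 'a) set" where
  "repetition L \<epsilon> l n = {z. \<exists>m\<le>L. wt z l m \<le> \<epsilon> \<and> (\<forall>a<m. z (n + a) = z (l + a))}"

text \<open>Reading letters one by one, the letter at \<open>c\<close> must copy the one at \<open>i + (c - j)\<close> as long as
  the word copied so far has weight more than \<open>\<epsilon>\<close>.\<close>

definition copying :: "nat \<Rightarrow> real \<Rightarrow> nat \<Rightarrow> nat \<Rightarrow> nat \<Rightarrow> (nat \<Rightarrow> 'a) \<Rightarrow> bool" where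
  "copying L \<epsilon> i j c z \<longleftrightarrow> j \<le> c \<and> c < j + L \<and> \<epsilon> < wt z i (c - j)"

lemma p_le_1: "p a \<le> 1"
proof -
  have "p a \<le> (\<Sum>a\<in>UNIV. p a)" by (intro member_le_sum) (auto simp: less_imp_le[OF p_pos])
  then show ?thesis by (simp add: p_sum)
qed

lemma wt_pos: "wt z i m > 0"
  unfolding wt_def by (intro prod_pos) (auto simp: p_pos)

lemma wt_0 [simp]: "wt z i 0 = 1"
  by (simp add: wt_def)

lemma wt_Suc: "wt z i (Suc m) = wt z i m * p (z (i + m))"
  by (simp add: wt_def)

lemma wt_antimono: "m \<le> m' \<Longrightarrow> wt z i m' \<le> wt z i m"
  by (rule lift_Suc_antimono_le[of "wt z i"])
    (simp_all add: wt_Suc mult_right_le_one_le less_imp_le[OF wt_pos] less_imp_le[OF p_pos] p_le_1)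

lemma wt_cong: "(\<And>a. a < m \<Longrightarrow> z (i + a) = z' (j + a)) \<Longrightarrow> wt z i m = wt z' j m"
  unfolding wt_def by (intro prod.cong) auto

lemma wt_le_power: "(\<And>a. p a \<le> r) \<Longrightarrow> wt z i m \<le> r ^ m"
  unfolding wt_def using prod_mono[of "{..<m}" "\<lambda>a. p (z (i + a))" "\<lambda>_. r"]
  by (simp add: less_imp_le[OF p_pos])

lemma repetition_commute: "repetition L \<epsilon> l n = repetition L \<epsilon> n l"
proof -
  have "repetition L \<epsilon> l n \<subseteq> repetition L \<epsilon> n l" for l n
  proof
    fix z assume "z \<in> repetition L \<epsilon> l n"
    then obtain m where m: "m \<le> L" "wt z l m \<le> \<epsilon>" "\<forall>a<m. z (n + a) = z (l + a)"
      by (auto simp: repetition_def)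
    then have "wt z n m = wt z l m" by (intro wt_cong) auto
    then show "z \<in> repetition L \<epsilon> n l" using m by (auto simp: repetition_def)
  qed
  then show ?thesis by blast
qed

lemma determined_repetition:
  assumes "{l..<l + L} \<subseteq> V" "{n..<n + L} \<subseteq> V"
  shows "determined V (repetition L \<epsilon> l n)"
proof -
  have "z' \<in> repetition L \<epsilon> l n"
    if eq: "\<forall>c\<in>V. z c = z' c" and z: "z \<in> repetition L \<epsilon> l n" for z z'
  proof -
    obtain m where m: "m \<le> L" "wt z l m \<le> \<epsilon>" "\<forall>a<m. z (n + a) = z (l + a)"
      using z by (auto simp: repetition_def)
    have e: "z (l + a) = z' (l + a) \<and> z (n + a) = z' (n + a)" if "a < m" for a
    proof -
      have "l + a \<in> {l..<l + L}" "n + a \<in> {n..<n + L}" using that m(1) by auto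
      then show ?thesis using eq assms by blast
    qed
    have "wt z' l m = wt z l m" using e by (intro wt_cong) auto
    then show ?thesis using m e by (auto simp: repetition_def intro!: exI[of _ m])
  qed
  then show ?thesis unfolding determined_def by metis
qed

lemma copying_dep:
  assumes "copying L \<epsilon> i j c z" "\<And>a. a < c - j \<Longrightarrow> z (i + a) = z' (i + a)"
  shows "copying L \<epsilon> i j c z'"
  using assms wt_cong[of "c - j" z i z' i] by (auto simp: copying_def)

text \<open>The least \<open>m\<close> with weight at most \<open>\<epsilon>\<close> is at most any
  witness of the repetition, and all shorter words weigh more than \<open>\<epsilon>\<close>. Hence
  \<open>copying\<close> is active exactly on an interval, and the product of \<open>p\<close> over
  it, which \<open>prob_copy_le\<close> and \<open>prob_copy_ge\<close> ask for, is a weight at most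
  \<open>\<epsilon>\<close>.\<close>

lemma repetition_copying:
  assumes "z \<in> repetition L \<epsilon> i j"
  obtains m where "m \<le> L" "wt z i m \<le> \<epsilon>" "\<And>a. a < m \<Longrightarrow> z (j + a) = z (i + a)"
    "\<And>c. copying L \<epsilon> i j c z \<longleftrightarrow> c \<in> {j..<j + m}"
    "(\<Prod>c\<in>{j..<j + m}. p (z c)) = wt z i m"
proof -
  obtain m' where m': "m' \<le> L" "wt z i m' \<le> \<epsilon>" "\<forall>a<m'. z (j + a) = z (i + a)"
    using assms by (auto simp: repetition_def)
  define m where "m = (LEAST m. wt z i m \<le> \<epsilon>)"
  have m: "wt z i m \<le> \<epsilon>" "m \<le> m'" unfolding m_def using m' by (auto intro: LeastI Least_le)
  have "copying L \<epsilon> i j c z \<longleftrightarrow> c \<in> {j..<j + m}" for c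
  proof
    assume c: "copying L \<epsilon> i j c z"
    have "c - j < m"
      using wt_antimono[of m "c - j" z i] m(1) c by (force simp: copying_def)
    then show "c \<in> {j..<j + m}" using c by (auto simp: copying_def)
  next
    assume c: "c \<in> {j..<j + m}"
    then have "c - j < m" by auto
    then have "\<epsilon> < wt z i (c - j)" unfolding m_def using not_less_Least not_le by blast
    then show "copying L \<epsilon> i j c z" using c m m' by (auto simp: copying_def)
  qed
  moreover have "(\<Prod>c\<in>{j..<j + m}. p (z c)) = (\<Prod>a<m. p (z (j + a)))"
    by (rule prod.reindex_bij_witness[of _ "\<lambda>a. j + a" "\<lambda>c. c - j"]) auto
  moreover have "\<dots> = wt z i m" unfolding wt_def using m m' by (intro prod.cong) auto
  ultimately show thesis using that[of m] m m' by auto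
qed

text \<open>When letters are revealed from left to right, every sequence that obeys the rule is a
  repetition, since \<open>r ^ L \<le> \<epsilon>\<close> lets the weight reach
  \<open>\<epsilon>\<close> within \<open>L\<close> letters. Before the last copied letter the
  weight exceeds \<open>\<epsilon>\<close>, so this letter undershoots by a factor \<open>p0\<close>
  at worst.\<close>

lemma prob_repetition_ge:
  assumes "l < n" "0 \<le> \<epsilon>" "\<epsilon> \<le> 1" "\<And>a. p0 \<le> p a" "\<And>a. p a \<le> r" "r ^ L \<le> \<epsilon>"
  shows "p0 * \<epsilon> \<le> iid.prob (repetition L \<epsilon> l n)"
proof (rule prob_copy_ge[where V = "{..<n + L}" and \<tau> = id and act = "copying L \<epsilon> l n" and s = "\<lambda>c. c - (n - l)"])
  fix c and z z' :: "nat \<Rightarrow> 'a"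
  assume c: "c \<in> {..<n + L}" and eq: "\<And>c'. c' \<in> {..<n + L} \<Longrightarrow> id c' < id c \<Longrightarrow> z c' = z' c'"
  have "z (l + a) = z' (l + a)" if "a < c - n" for a using that c assms by (intro eq) auto
  then show "copying L \<epsilon> l n c z = copying L \<epsilon> l n c z'"
    using copying_dep[of L \<epsilon> l n c z z'] copying_dep[of L \<epsilon> l n c z' z] by auto
next
  fix z assume z: "\<forall>c\<in>{..<n + L}. copying L \<epsilon> l n c z \<longrightarrow> z c = z (c - (n - l))"
  define m where "m = (LEAST m. wt z l m \<le> \<epsilon>)"
  have L: "wt z l L \<le> \<epsilon>" using wt_le_power[of r z l L] assms by simp
  have m: "wt z l m \<le> \<epsilon>" "m \<le> L" unfolding m_def using L by (auto intro: LeastI Least_le)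
  have less: "\<epsilon> < wt z l k" if "k < m" for k using that unfolding m_def using not_less_Least not_le by blast
  have "z (n + a) = z (l + a)" if "a < m" for a
    using z[rule_format, of "n + a"] less[OF that] that m assms by (auto simp: copying_def add.commute)
  then have rep: "z \<in> repetition L \<epsilon> l n" using m by (auto simp: repetition_def)
  then obtain m' where m': "m' \<le> L" "wt z l m' \<le> \<epsilon>"
    "\<And>c. copying L \<epsilon> l n c z \<longleftrightarrow> c \<in> {n..<n + m'}"
    "(\<Prod>c\<in>{n..<n + m'}. p (z c)) = wt z l m'"
    by (rule repetition_copying) blast
  have "wt z l m' \<ge> p0 * \<epsilon>"
  \<comment> \<open>\<open>m' = 0\<close> occurs only for \<open>\<epsilon> = 1\<close>; the product
    is then empty.\<close>
  proof (cases m')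
    case 0
    have "p0 * \<epsilon> \<le> 1 * 1" 
      by (rule mult_mono) (use assms order_trans[OF assms(4) p_le_1] in auto)
    then show ?thesis using 0 by simp
  next
    case (Suc k)
    then have "copying L \<epsilon> l n (n + k) z" using m'(3) by auto
    then have "\<epsilon> \<le> wt z l k" by (auto simp: copying_def)
    then have "\<epsilon> * p (z (l + k)) \<le> wt z l k * p (z (l + k))"
      by (rule mult_right_mono) (rule less_imp_le[OF p_pos])
    moreover have "\<epsilon> * p0 \<le> \<epsilon> * p (z (l + k))" using assms by (intro mult_left_mono) auto
    ultimately show ?thesis using Suc by (simp add: wt_Suc mult.commute)
  qed
  moreover have "{c \<in> {..<n + L}. c \<in> {n..<n + m'}} = {n..<n + m'}" using m'(1) by auto
  ultimately show "z \<in> repetition L \<epsilon> l n \<and> p0 * \<epsilon> \<le> (\<Prod>c\<in>{c \<in> {..<n + L}. copying L \<epsilon> l n c z}. p (z c))"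
    unfolding m'(3) using rep m'(4) by simp
qed (use assms in \<open>auto simp: copying_def intro!: determined_repetition\<close>)

text \<open>\<open>H\<close> separates the low blocks at \<open>l\<close>, \<open>l'\<close> from
  the high blocks at \<open>n\<close>, \<open>n'\<close>. The first repetition is read upwards and
  the second downwards, so no position is a copy in both. A chain from copy to source goes down by
  \<open>n - l\<close> and up by \<open>n' - l'\<close> alternately; \<open>n' + l < n + l'\<close>
  says that down wins, so no chain closes and both words are paid for in full.\<close>

lemma prob_repetition_offdiagonal:
  assumes "l + L \<le> H" "l' + L \<le> H" "H \<le> n" "H \<le> n'" "n \<le> l + H" "l' \<le> n'" "n' + l < n + l'" "0 \<le> \<epsilon>"
  shows "iid.prob (repetition L \<epsilon> l n \<inter> repetition L \<epsilon> l' n') \<le> \<epsilon>\<^sup>2"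
proof -
  define V where "V = {..<n + n' + L}"
  \<comment> \<open>interleaves the two blocks so that in both repetitions the source precedes the copy, the second
    repetition being read from \<open>n'\<close> to \<open>l'\<close>\<close>
  define \<tau> where "\<tau> c = (if c < H then 2 * c else 2 * (c - (n - l)) + 1)" for c :: nat
  define act where "act c z \<longleftrightarrow> copying L \<epsilon> l n c z \<or> copying L \<epsilon> n' l' c z" for c z
  define s where "s c = (if c < H then c + (n' - l') else c - (n - l))" for c
  have ln: "n - l \<le> H" "l \<le> n" using assms by auto
  show ?thesis
  proof (rule prob_copy_le[where V = V and \<tau> = \<tau> and act = act and s = s])
    show "inj_on \<tau> V"
    proof (rule inj_onI)
      fix c c' assume eq: "\<tau> c = \<tau> c'"
      have "odd (\<tau> c) \<longleftrightarrow> H \<le> c" "odd (\<tau> c') \<longleftrightarrow> H \<le> c'" by (auto simp: \<tau>_def)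
      then have "H \<le> c \<longleftrightarrow> H \<le> c'" using eq by simp
      then show "c = c'" using eq ln by (cases "c < H") (auto simp: \<tau>_def)
    qed
  next
    have *: "act c z'" if c: "c \<in> V" and eq: "\<And>c'. c' \<in> V \<Longrightarrow> \<tau> c' < \<tau> c \<Longrightarrow> z c' = z' c'" and act: "act c z"
      for c and z z' :: "nat \<Rightarrow> 'a"
      using act unfolding act_def
    proof (elim disjE)
      assume A: "copying L \<epsilon> l n c z"
      have "z (l + a) = z' (l + a)" if "a < c - n" for a
      proof (rule eq)
        show "l + a \<in> V" using A that assms unfolding copying_def V_def by auto
        show "\<tau> (l + a) < \<tau> c" using A that assms ln unfolding copying_def \<tau>_def by auto
      qed
      then show "copying L \<epsilon> l n c z' \<or> copying L \<epsilon> n' l' c z'" using copying_dep[OF A] by blast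
    next
      assume A: "copying L \<epsilon> n' l' c z"
      have "z (n' + a) = z' (n' + a)" if "a < c - l'" for a
      proof (rule eq)
        show "n' + a \<in> V" using A that assms unfolding copying_def V_def by auto
        show "\<tau> (n' + a) < \<tau> c" using A that assms ln unfolding copying_def \<tau>_def by auto
      qed
      then show "copying L \<epsilon> l n c z' \<or> copying L \<epsilon> n' l' c z'" using copying_dep[OF A] by blast
    qed
    fix c and z z' :: "nat \<Rightarrow> 'a"
    assume c: "c \<in> V" and eq: "\<And>c'. c' \<in> V \<Longrightarrow> \<tau> c' < \<tau> c \<Longrightarrow> z c' = z' c'"
    show "act c z = act c z'" using *[OF c, of z z'] *[OF c, of z' z] eq by auto
  next
    fix c and z :: "nat \<Rightarrow> 'a" assume "c \<in> V" "act c z"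
    then show "s c \<in> V \<and> \<tau> (s c) < \<tau> c"
      using assms ln unfolding s_def \<tau>_def V_def act_def copying_def by auto
  next
    show "determined V (repetition L \<epsilon> l n \<inter> repetition L \<epsilon> l' n')"
      using assms unfolding V_def by (intro determined_Int determined_repetition) auto
  next
    fix z assume z: "z \<in> repetition L \<epsilon> l n \<inter> repetition L \<epsilon> l' n'"
    then have z': "z \<in> repetition L \<epsilon> l n" "z \<in> repetition L \<epsilon> n' l'"
      using repetition_commute by blast+
    obtain m where m: "m \<le> L" "wt z l m \<le> \<epsilon>" "\<And>a. a < m \<Longrightarrow> z (n + a) = z (l + a)"
      "\<And>c. copying L \<epsilon> l n c z \<longleftrightarrow> c \<in> {n..<n + m}"
      "(\<Prod>c\<in>{n..<n + m}. p (z c)) = wt z l m"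
      using z'(1) by (rule repetition_copying) blast
    obtain m' where m': "m' \<le> L" "wt z n' m' \<le> \<epsilon>" "\<And>a. a < m' \<Longrightarrow> z (l' + a) = z (n' + a)"
      "\<And>c. copying L \<epsilon> n' l' c z \<longleftrightarrow> c \<in> {l'..<l' + m'}"
      "(\<Prod>c\<in>{l'..<l' + m'}. p (z c)) = wt z n' m'"
      using z'(2) by (rule repetition_copying) blast
    have "z c = z (s c)" if "act c z" for c
    proof (cases "c < H")
      case True
      then have "l' \<le> c" "c < l' + m'" using that m(4) m'(4) assms unfolding act_def by auto
      then show ?thesis using m'(3)[of "c - l'"] assms True by (simp add: s_def add.commute)
    next
      case False
      then have "n \<le> c" "c < n + m" using that m(4) m'(4) m'(1) assms unfolding act_def by auto
      moreover from this have "l + (c - n) = c - (n - l)" using assms by auto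
      ultimately show ?thesis using m(3)[of "c - n"] False by (simp add: s_def)
    qed
    moreover have "{c \<in> V. act c z} = {n..<n + m} \<union> {l'..<l' + m'}"
      using m m' assms unfolding act_def V_def by auto
    moreover have "(\<Prod>c\<in>{n..<n + m} \<union> {l'..<l' + m'}. p (z c)) = wt z l m * wt z n' m'"
      using m(1,5) m'(1,5) assms by (subst prod.union_disjoint) auto
    moreover have "wt z l m * wt z n' m' \<le> \<epsilon>\<^sup>2"
      unfolding power2_eq_square using m(2) m'(2) assms by (intro mult_mono) (auto simp: less_imp_le[OF wt_pos])
    ultimately show "(\<forall>c\<in>V. act c z \<longrightarrow> z c = z (s c)) \<and> (\<Prod>c\<in>{c \<in> V. act c z}. p (z c)) \<le> \<epsilon>\<^sup>2"
      by simp
  qed (auto simp: V_def)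
qed

text \<open>With equal gaps both repetitions prescribe the same source \<open>c - (n - l)\<close>,
  so overlapping constraints coincide. If the first copied word has at least \<open>k\<close>
  letters, its first \<open>k\<close> letters precede the second word and the two give
  \<open>r ^ k * \<epsilon>\<close>; otherwise the words are disjoint and give
  \<open>\<epsilon>\<^sup>2\<close>. The sum of the bounds covers both cases.\<close>

lemma prob_repetition_diagonal:
  assumes "l < n" "0 \<le> \<epsilon>" "\<And>a. p a \<le> r"
  shows "iid.prob (repetition L \<epsilon> l n \<inter> repetition L \<epsilon> (l + k) (n + k)) \<le> r ^ k * \<epsilon> + \<epsilon>\<^sup>2"
proof -
  have r: "0 \<le> r" using assms(3)[of undefined] p_pos[of undefined] by linarith
  define V where "V = {..<n + k + L}"
  define act where "act c z \<longleftrightarrow> copying L \<epsilon> l n c z \<or> copying L \<epsilon> (l + k) (n + k) c z" for c z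
  define s where "s c = c - (n - l)" for c
  show ?thesis
  proof (rule prob_copy_le[where V = V and \<tau> = id and act = act and s = s])
    have *: "act c z'" if c: "c \<in> V" and eq: "\<And>c'. c' \<in> V \<Longrightarrow> id c' < id c \<Longrightarrow> z c' = z' c'" and act: "act c z"
      for c and z z' :: "nat \<Rightarrow> 'a"
      using act unfolding act_def
    proof (elim disjE)
      assume A: "copying L \<epsilon> l n c z"
      have "z (l + a) = z' (l + a)" if "a < c - n" for a
        using A that c assms unfolding copying_def V_def by (intro eq) (auto simp: V_def)
      then show "copying L \<epsilon> l n c z' \<or> copying L \<epsilon> (l + k) (n + k) c z'" using copying_dep[OF A] by blast
    next
      assume A: "copying L \<epsilon> (l + k) (n + k) c z"
      have "z (l + k + a) = z' (l + k + a)" if "a < c - (n + k)" for a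
        using A that c assms unfolding copying_def V_def by (intro eq) (auto simp: V_def)
      then show "copying L \<epsilon> l n c z' \<or> copying L \<epsilon> (l + k) (n + k) c z'" using copying_dep[OF A] by blast
    qed
    fix c and z z' :: "nat \<Rightarrow> 'a"
    assume c: "c \<in> V" and eq: "\<And>c'. c' \<in> V \<Longrightarrow> id c' < id c \<Longrightarrow> z c' = z' c'"
    show "act c z = act c z'" using *[OF c, of z z'] *[OF c, of z' z] eq by auto
  next
    fix c and z :: "nat \<Rightarrow> 'a" assume "c \<in> V" "act c z"
    then show "s c \<in> V \<and> id (s c) < id c"
      using assms unfolding s_def V_def act_def copying_def by auto
  next
    show "determined V (repetition L \<epsilon> l n \<inter> repetition L \<epsilon> (l + k) (n + k))"
      using assms unfolding V_def by (intro determined_Int determined_repetition) auto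
  next
    fix z assume z: "z \<in> repetition L \<epsilon> l n \<inter> repetition L \<epsilon> (l + k) (n + k)"
    obtain m where m: "m \<le> L" "wt z l m \<le> \<epsilon>" "\<And>a. a < m \<Longrightarrow> z (n + a) = z (l + a)"
      "\<And>c. copying L \<epsilon> l n c z \<longleftrightarrow> c \<in> {n..<n + m}"
      "(\<Prod>c\<in>{n..<n + m}. p (z c)) = wt z l m"
      using IntD1[OF z] by (rule repetition_copying) blast
    obtain m' where m': "m' \<le> L" "wt z (l + k) m' \<le> \<epsilon>" "\<And>a. a < m' \<Longrightarrow> z (n + k + a) = z (l + k + a)"
      "\<And>c. copying L \<epsilon> (l + k) (n + k) c z \<longleftrightarrow> c \<in> {n + k..<n + k + m'}"
      "(\<Prod>c\<in>{n + k..<n + k + m'}. p (z c)) = wt z (l + k) m'"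
      using IntD2[OF z] by (rule repetition_copying) blast
    have "z c = z (s c)" if "act c z" for c
    proof (cases "c \<in> {n..<n + m}")
      case True
      then have "l + (c - n) = c - (n - l)" "n \<le> c" "c < n + m" using assms by auto
      then show ?thesis using m(3)[of "c - n"] by (simp add: s_def)
    next
      case False
      then have "n + k \<le> c" "c < n + k + m'" using that m(4) m'(4) unfolding act_def by auto
      moreover from this have "l + k + (c - (n + k)) = c - (n - l)" using assms by auto
      ultimately show ?thesis using m'(3)[of "c - (n + k)"] by (simp add: s_def)
    qed
    moreover have "(\<Prod>c\<in>{c \<in> V. act c z}. p (z c)) \<le> r ^ k * \<epsilon> + \<epsilon>\<^sup>2"
    proof (cases "k \<le> m")
      case True
      have "{c \<in> V. act c z} \<supseteq> {n..<n + k} \<union> {n + k..<n + k + m'}"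
        using m m' True unfolding act_def V_def by auto
      then have "(\<Prod>c\<in>{c \<in> V. act c z}. p (z c)) \<le> (\<Prod>c\<in>{n..<n + k} \<union> {n + k..<n + k + m'}. p (z c))"
        by (intro prod_le_prod_subset) (auto simp: V_def p_le_1 less_imp_le[OF p_pos])
      also have "\<dots> = (\<Prod>c\<in>{n..<n + k}. p (z c)) * wt z (l + k) m'"
        using m'(5) by (subst prod.union_disjoint) auto
      also have "\<dots> \<le> r ^ k * \<epsilon>"
      proof (rule mult_mono)
        have "(\<Prod>c\<in>{n..<n + k}. p (z c)) \<le> (\<Prod>c\<in>{n..<n + k}. r)"
          by (intro prod_mono) (auto simp: assms less_imp_le[OF p_pos])
        then show "(\<Prod>c\<in>{n..<n + k}. p (z c)) \<le> r ^ k" by simp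
      qed (use m' assms r in \<open>auto simp: less_imp_le[OF wt_pos]\<close>)
      finally show ?thesis by (simp add: add_increasing2)
    next
      case False
      have "{c \<in> V. act c z} \<supseteq> {n..<n + m} \<union> {n + k..<n + k + m'}"
        using m m' False unfolding act_def V_def by auto
      then have "(\<Prod>c\<in>{c \<in> V. act c z}. p (z c)) \<le> (\<Prod>c\<in>{n..<n + m} \<union> {n + k..<n + k + m'}. p (z c))"
        by (intro prod_le_prod_subset) (auto simp: V_def p_le_1 less_imp_le[OF p_pos])
      also have "\<dots> = wt z l m * wt z (l + k) m'"
        using m(5) m'(5) False by (subst prod.union_disjoint) auto
      also have "\<dots> \<le> \<epsilon>\<^sup>2"
        unfolding power2_eq_square using m(2) m'(2) assms by (intro mult_mono) (auto simp: less_imp_le[OF wt_pos])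
      finally show ?thesis using r assms by (simp add: add_increasing)
    qed
    ultimately show "(\<forall>c\<in>V. act c z \<longrightarrow> z c = z (s c)) \<and> (\<Prod>c\<in>{c \<in> V. act c z}. p (z c)) \<le> r ^ k * \<epsilon> + \<epsilon>\<^sup>2"
      by simp
  qed (use r assms in \<open>auto simp: V_def\<close>)
qed

text \<open>In these windows \<open>H = 3 * N\<close> separates:
  \<open>l + L \<le> 3 * N \<le> n\<close> and \<open>n - l \<le> 3 * N\<close>. Whichever gap is
  larger takes the role of the first repetition; equal gaps mean a common translation by
  \<open>k\<close>.\<close>

lemma prob_repetition_pair:
  assumes "l \<in> {N..<2*N}" "l' \<in> {N..<2*N}" "n \<in> {3*N..<4*N}" "n' \<in> {3*N..<4*N}" "L \<le> N" "0 \<le> \<epsilon>"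
    and "\<And>a. p a \<le> r"
  shows "iid.prob (repetition L \<epsilon> l n \<inter> repetition L \<epsilon> l' n')
    \<le> \<epsilon>\<^sup>2 + (if n' + l = n + l' then r ^ nat \<bar>int l - int l'\<bar> * \<epsilon> else 0)"
proof -
  consider "n' + l < n + l'" | "n + l' < n' + l" | k where "l' = l + k" "n' = n + k" | k where "l = l' + k" "n = n' + k"
  proof -
    consider "n' + l < n + l'" | "n + l' < n' + l" | "n + l' = n' + l" "l \<le> l'" | "n + l' = n' + l" "l' < l" by linarith
    then show thesis
    proof cases
      case 3 then show thesis using that(3)[of "l' - l"] by simp
    next
      case 4 then show thesis using that(4)[of "l - l'"] by simp
    qed (use that in auto)
  qed
  then show ?thesis
  proof cases
    case 1
    then have "iid.prob (repetition L \<epsilon> l n \<inter> repetition L \<epsilon> l' n') \<le> \<epsilon>\<^sup>2"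
      using assms by (intro prob_repetition_offdiagonal[where H = "3 * N"]) auto
    then show ?thesis using 1 by simp
  next
    case 2
    then have "iid.prob (repetition L \<epsilon> l' n' \<inter> repetition L \<epsilon> l n) \<le> \<epsilon>\<^sup>2"
      using assms by (intro prob_repetition_offdiagonal[where H = "3 * N"]) auto
    then show ?thesis using 2 by (simp add: Int_commute)
  next
    case 3
    then show ?thesis using prob_repetition_diagonal[of l n \<epsilon> r L k] assms by (simp add: algebra_simps)
  next
    case 4
    then show ?thesis using prob_repetition_diagonal[of l' n' \<epsilon> r L k] assms by (simp add: Int_commute algebra_simps)
  qed
qed

text \<open>With \<open>T = N\<^sup>2 * \<epsilon>\<close> the first moment is at least
  \<open>p0 * T\<close> and the second at most \<open>C * T\<close>: the bound
  \<open>\<epsilon>\<^sup>2\<close> for all pairs adds up to \<open>T\<^sup>2 \<le> T\<close>, which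
  is where \<open>N\<^sup>2 * \<epsilon> \<le> 1\<close> enters, and the diagonals add a geometric
  series.\<close>

lemma prob_repetition_block:
  assumes r: "\<And>a. p a \<le> r" "r < 1" and p0: "0 < p0" "\<And>a. p0 \<le> p a"
    and L: "L \<le> N" "r ^ L \<le> \<epsilon>" and \<epsilon>: "0 \<le> \<epsilon>" "(real N)\<^sup>2 * \<epsilon> \<le> 1" and N: "1 \<le> N"
  shows "p0\<^sup>2 / (1 + 2 / (1 - r)) * ((real N)\<^sup>2 * \<epsilon>)
    \<le> iid.prob (\<Union>(l, n)\<in>{N..<2*N} \<times> {3*N..<4*N}. repetition L \<epsilon> l n)"
proof -
  let ?I = "{N..<2*N} \<times> {3*N..<4*N}"
  define A where "A = (\<lambda>(l, n). repetition L \<epsilon> l n)"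
  define C where "C = 1 + 2 / (1 - r)"
  define T where "T = (real N)\<^sup>2 * \<epsilon>"
  have r0: "0 \<le> r" using r(1)[of undefined] p_pos[of undefined] by linarith
  have "0 < C" using r r0 by (auto simp: C_def intro!: add_pos_nonneg)
  have card: "real (card ?I) = (real N)\<^sup>2" by (simp add: power2_eq_square)
  have \<epsilon>1: "\<epsilon> \<le> 1"
  proof -
    have "1 * \<epsilon> \<le> (real N)\<^sup>2 * \<epsilon>" using N \<epsilon> by (intro mult_right_mono) (auto simp: one_le_power)
    then show ?thesis using \<epsilon> by simp
  qed
  have S1: "p0 * T \<le> (\<Sum>i\<in>?I. iid.prob (A i))"
  proof -
    have "p0 * T = (\<Sum>i\<in>?I. p0 * \<epsilon>)" by (simp add: T_def card[symmetric])
    also have "\<dots> \<le> (\<Sum>i\<in>?I. iid.prob (A i))"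
    proof (rule sum_mono)
      fix i assume "i \<in> ?I"
      then show "p0 * \<epsilon> \<le> iid.prob (A i)"
        unfolding A_def using L r p0 \<epsilon> \<epsilon>1 by (cases i) (auto intro!: prob_repetition_ge[where r = r])
    qed
    finally show ?thesis .
  qed
  have S2: "(\<Sum>i\<in>?I. \<Sum>j\<in>?I. iid.prob (A i \<inter> A j)) \<le> C * T"
  proof -
    have row: "(\<Sum>j\<in>?I. iid.prob (A i \<inter> A j)) \<le> C * \<epsilon>" if iI: "i \<in> ?I" for i
    proof -
      obtain l n where i: "i = (l, n)" "l \<in> {N..<2*N}" "n \<in> {3*N..<4*N}" using iI by (rule SigmaE)
      let ?d = "\<lambda>l'. r ^ nat \<bar>int l - int l'\<bar> * \<epsilon>"
      have "(\<Sum>j\<in>?I. iid.prob (A i \<inter> A j))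
        \<le> (\<Sum>(l', n')\<in>?I. \<epsilon>\<^sup>2 + (if n' + l = n + l' then ?d l' else 0))"
        unfolding A_def using i assms by (intro sum_mono) (auto intro!: prob_repetition_pair simp del: power2_eq_square)
      also have "\<dots> = T * \<epsilon> + (\<Sum>l'\<in>{N..<2*N}. \<Sum>n'\<in>{3*N..<4*N}. if n' + l = n + l' then ?d l' else 0)"
        by (simp add: sum.distrib case_prod_unfold sum.cartesian_product T_def power2_eq_square)
      also have "\<dots> \<le> T * \<epsilon> + (\<Sum>l'\<in>{N..<2*N}. ?d l')"
      proof (intro add_left_mono sum_mono)
        fix l'
        \<comment> \<open>For a given \<open>l'\<close> the diagonal contains at most one
          \<open>n'\<close>.\<close>
        have "card {n' \<in> {3*N..<4*N}. n' + l = n + l'} \<le> card {n + l' - l}" by (intro card_mono) auto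
        then have "card {n' \<in> {3*N..<4*N}. n' + l = n + l'} * ?d l' \<le> 1 * ?d l'"
          using r0 \<epsilon> by (intro mult_right_mono) auto
        then show "(\<Sum>n'\<in>{3*N..<4*N}. if n' + l = n + l' then ?d l' else 0) \<le> ?d l'"
          by (simp add: sum.inter_filter[symmetric])
      qed
      also have "(\<Sum>l'\<in>{N..<2*N}. ?d l') \<le> 2 / (1 - r) * \<epsilon>"
        unfolding sum_distrib_right[symmetric] using r0 r \<epsilon> by (intro mult_right_mono sum_geometric_dist_le) auto
      also have "T * \<epsilon> \<le> 1 * \<epsilon>" unfolding T_def using \<epsilon> by (intro mult_right_mono)
      finally show ?thesis by (simp add: C_def algebra_simps)
    qed
    have "(\<Sum>i\<in>?I. \<Sum>j\<in>?I. iid.prob (A i \<inter> A j)) \<le> (\<Sum>i\<in>?I. C * \<epsilon>)" by (intro sum_mono row)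
    also have "\<dots> = C * T" by (simp add: T_def card[symmetric])
    finally show ?thesis .
  qed
  \<comment> \<open>This \<open>c\<close> maximises
    \<open>2 * c * (p0 * T) - c\<^sup>2 * (C * T)\<close>.\<close>
  define c where "c = p0 / C"
  have c: "0 \<le> c" using p0 \<open>0 < C\<close> by (simp add: c_def)
  have "p0\<^sup>2 / C * T = 2 * c * (p0 * T) - c\<^sup>2 * (C * T)"
    using \<open>0 < C\<close> by (simp add: c_def power2_eq_square field_simps)
  also have "\<dots> \<le> 2 * c * (\<Sum>i\<in>?I. iid.prob (A i)) - c\<^sup>2 * (\<Sum>i\<in>?I. \<Sum>j\<in>?I. iid.prob (A i \<inter> A j))"
    using S1 S2 c by (intro diff_mono mult_left_mono) auto
  also have "\<dots> \<le> iid.prob (\<Union>i\<in>?I. A i)"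
    by (rule iid.prob_UN_ge_second_moment) (auto simp: A_def intro!: sets_determined[of "{..<5*N+L}"] determined_repetition)
  finally show ?thesis by (simp add: C_def T_def A_def)
qed

end

text \<open>Cauchy condensation in base 8: the block from \<open>8 ^ K\<close> has
  \<open>7 * 8 ^ K\<close> terms, each at most \<open>8 ^ Suc K * G (8 ^ K)\<close>, whence
  \<open>56 * 64 ^ K * G (8 ^ K)\<close>.\<close>

lemma summable_condensation_8:
  fixes G :: "nat \<Rightarrow> real"
  assumes nonneg: "\<And>n. 1 \<le> n \<Longrightarrow> 0 \<le> G n" and anti: "\<And>m n. 1 \<le> m \<Longrightarrow> m \<le> n \<Longrightarrow> G n \<le> G m"
    and sm: "summable (\<lambda>k. 64 ^ k * G (8 ^ k))"
  shows "summable (\<lambda>n. real n * G n)"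
proof -
  have block: "(\<Sum>n=1..<8 ^ K. real n * G n) \<le> (\<Sum>k<K. 64 * (64 ^ k * G (8 ^ k)))" for K
  proof (induction K)
    case (Suc K)
    have "(\<Sum>n=1..<8 ^ Suc K. real n * G n) = (\<Sum>n=1..<8 ^ K. real n * G n) + (\<Sum>n=8 ^ K..<8 ^ Suc K. real n * G n)"
      by (rule sum.atLeastLessThan_concat[symmetric]) auto
    also have "(\<Sum>n=8 ^ K..<8 ^ Suc K. real n * G n) \<le> (\<Sum>n=8 ^ K..<8 ^ Suc K::nat. 8 ^ Suc K * G (8 ^ K))"
    proof (rule sum_mono)
      fix n :: nat assume n: "n \<in> {8 ^ K..<8 ^ Suc K}"
      then have "1 \<le> n" by (meson atLeastLessThan_iff one_le_numeral one_le_power order_trans)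
      moreover have "real n \<le> 8 ^ Suc K" using n by (metis atLeastLessThan_iff less_imp_le of_nat_le_iff of_nat_numeral of_nat_power)
      ultimately show "real n * G n \<le> 8 ^ Suc K * G (8 ^ K)"
        using n by (intro mult_mono nonneg anti) auto
    qed
    also have "\<dots> = (8 ^ Suc K - 8 ^ K) * (8 ^ Suc K * G (8 ^ K))"
      by (simp add: of_nat_diff)
    also have "\<dots> = 56 * ((8 * 8) ^ K * G (8 ^ K))"
      unfolding power_mult_distrib by (simp add: algebra_simps)
    also have "\<dots> \<le> 64 * (64 ^ K * G (8 ^ K))" using nonneg[of "8 ^ K"] by (simp add: mult_right_mono)
    finally show ?case using Suc.IH by simp
  qed simp
  show ?thesis
  proof (rule bounded_imp_summable)
    show "0 \<le> real n * G n" for n using nonneg[of n] by (cases n) auto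
    fix n
    have "n < 8 ^ n" by (rule less_le_trans[OF less_exp], rule power_mono) auto
    have "(\<Sum>k\<le>n. real k * G k) = (\<Sum>k=1..n. real k * G k)"
      by (rule sum.mono_neutral_right) (auto simp: not_le Suc_le_eq)
    also have "\<dots> \<le> (\<Sum>k=1..<8 ^ n. real k * G k)"
      using \<open>n < 8 ^ n\<close> nonneg by (intro sum_mono2) auto
    also have "\<dots> \<le> (\<Sum>k<n. 64 * (64 ^ k * G (8 ^ k)))" by (rule block)
    also have "\<dots> \<le> (\<Sum>k. 64 * (64 ^ k * G (8 ^ k)))"
      using sm nonneg by (intro sum_le_suminf summable_mult) auto
    finally show "(\<Sum>k\<le>n. real k * G k) \<le> (\<Sum>k. 64 * (64 ^ k * G (8 ^ k)))" .
  qed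
qed

section \<open>Infinitely many repetitions almost surely\<close>

context letter_weights
begin

text \<open>\<open>G\<close> is taken at the right end of a block, where it is smallest, so that the
  bound serves every period end \<open>n\<close> in the block. The condition
  \<open>l + m \<le> n\<close> keeps the copied word within one period, and
  \<open>0 < G (8 ^ Suc k)\<close> will make the approximation strict.\<close>

lemma AE_infinitely_many_repetitions:
  fixes G :: "nat \<Rightarrow> real"
  assumes p1: "\<And>a. p a < 1"
    and nonneg: "\<And>n. 1 \<le> n \<Longrightarrow> 0 \<le> G n" and anti: "\<And>m n. 1 \<le> m \<Longrightarrow> m \<le> n \<Longrightarrow> G n \<le> G m"
    and div: "\<not> summable (\<lambda>n. real n * G n)"
  shows "AE z in iid. infinite {k. \<exists>l n m. 8 ^ k \<le> l \<and> l < n \<and> l + m \<le> n \<and> n \<le> 8 ^ Suc k \<and> 0 < G (8 ^ Suc k)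
    \<and> wt z l m \<le> G (8 ^ Suc k) \<and> (\<forall>a<m. z (n + a) = z (l + a))}"
proof -
  define r where "r = Max (range p)"
  define p0 where "p0 = Min (range p)"
  have r: "p a \<le> r" "r < 1" for a using p1 by (auto simp: r_def)
  have p0: "p0 \<le> p a" "0 < p0" for a using p_pos by (auto simp: p0_def)
  have r0: "0 < r" using r(1)[of undefined] p_pos[of undefined] by linarith
  \<comment> \<open>\<open>512 = 8 * 64\<close>: with this \<open>A\<close>, words of
    \<open>A * k\<close> letters weigh at most \<open>(1 / 8) ^ k / 64 ^ k\<close>, the smallest
    \<open>\<epsilon> k\<close> that a good \<open>k\<close> admits.\<close>
  obtain A where A: "r ^ A < 1 / 512" using real_arch_pow_inv[of "1 / 512" r] r by auto
  \<comment> \<open>Cut off at the inverse of the number \<open>64 ^ k\<close> of pairs, so that the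
    expected number of repetitions, which is of the order of \<open>T k\<close>, stays
    bounded.\<close>
  define \<epsilon> where "\<epsilon> k = min (G (8 ^ Suc k)) (1 / 64 ^ k)" for k
  define T where "T k = 64 ^ k * \<epsilon> k" for k
  \<comment> \<open>The discarded indices contribute to \<open>T\<close> no more than a geometric
    series, apart from the finitely many below \<open>A\<close>.\<close>
  define good where "good k \<longleftrightarrow> A \<le> k \<and> (1 / 8) ^ k \<le> T k" for k
  define E where "E k = (if good k then \<Union>(l, n)\<in>{8 ^ k..<2 * 8 ^ k} \<times> {3 * 8 ^ k..<4 * 8 ^ k}. repetition (A * k) (\<epsilon> k) l n else {})" for k
  define C where "C = p0\<^sup>2 / (1 + 2 / (1 - r))"
  have C: "0 < C" using p0 r r0 by (auto simp: C_def intro!: divide_pos_pos add_pos_nonneg)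
  have \<epsilon>: "0 \<le> \<epsilon> k" for k using nonneg[of "8 ^ Suc k"] by (auto simp: \<epsilon>_def)
  have T_le: "T k \<le> 1" for k
    using mult_left_mono[of "\<epsilon> k" "1 / 64 ^ k" "64 ^ k"] by (simp add: T_def \<epsilon>_def)
  have AL: "A * k \<le> 8 ^ k" if "A \<le> k" for k
  proof -
    have "A * k \<le> k * k" using that by simp
    also have "\<dots> \<le> 2 ^ k * 2 ^ k" using less_exp[of k] by (intro mult_mono) auto
    also have "\<dots> = (2 * 2) ^ k" by (simp only: power_mult_distrib)
    also have "\<dots> \<le> 8 ^ k" by (rule power_mono) auto
    finally show ?thesis .
  qed
  \<comment> \<open>The letters read lie between \<open>8 ^ k\<close> and \<open>5 * 8 ^ k\<close>,
    inside the block; since blocks are disjoint, the events \<open>E k\<close> are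
    independent.\<close>
  have det: "determined {8 ^ k..<8 ^ Suc k} (E k)" for k
  proof (cases "good k")
    case True
    then have "A * k \<le> 8 ^ k" using AL by (simp add: good_def)
    then show ?thesis using True unfolding E_def by (auto intro!: determined_UN determined_repetition)
  qed (simp add: E_def determined_def)
  have disj: "{8 ^ k..<8 ^ Suc k} \<inter> {8 ^ j..<8 ^ Suc j} = ({} :: nat set)" if "k \<noteq> j" for k j :: nat
  proof -
    have "(8::nat) ^ Suc k \<le> 8 ^ j \<or> (8::nat) ^ Suc j \<le> 8 ^ k"
      using that by (cases "k < j") (auto simp del: power_Suc intro!: power_increasing)
    then show ?thesis by (auto simp del: power_Suc)
  qed
  have low: "C * T k \<le> iid.prob (E k)" if "good k" for k
  proof -
    have N: "(real (8 ^ k))\<^sup>2 = 64 ^ k" by (simp add: power2_eq_square flip: power_mult_distrib)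
    have "(1 / 8) ^ k / 64 ^ k \<le> \<epsilon> k"
      using that by (simp add: good_def T_def field_simps)
    moreover have "(1 / 8) ^ k / 64 ^ k = (1 / 512 :: real) ^ k" by (simp flip: power_divide)
    moreover have "r ^ (A * k) \<le> (1 / 512) ^ k" unfolding power_mult using A r0 by (intro power_mono) auto
    ultimately have "r ^ (A * k) \<le> \<epsilon> k" by linarith
    then have "C * ((real (8 ^ k))\<^sup>2 * \<epsilon> k)
      \<le> iid.prob (\<Union>(l, n)\<in>{8 ^ k..<2 * 8 ^ k} \<times> {3 * 8 ^ k..<4 * 8 ^ k}. repetition (A * k) (\<epsilon> k) l n)"
      unfolding C_def using r p0 \<epsilon> T_le[of k] AL[of k] that
      by (intro prob_repetition_block) (auto simp: good_def T_def N[simplified])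
    then show ?thesis using that by (simp only: N T_def E_def if_True)
  qed
  have "\<not> summable T"
  proof
    assume T: "summable T"
    \<comment> \<open>Once \<open>T k < 1\<close> the cut-off is inactive, so \<open>T\<close> is
      eventually the condensed series of \<open>G\<close>, shifted by one block.\<close>
    then have "T \<longlonglongrightarrow> 0" by (rule summable_LIMSEQ_zero)
    then have "\<forall>\<^sub>F k in sequentially. T k < 1" by (rule order_tendstoD) simp
    then have "\<forall>\<^sub>F k in sequentially. T k = 64 ^ k * G (8 ^ Suc k)"
      by eventually_elim (auto simp: T_def \<epsilon>_def min_def split: if_splits)
    then have "summable (\<lambda>k. 64 ^ k * G (8 ^ Suc k))" using T summable_cong by fastforce
    then have "summable (\<lambda>k. 64 * (64 ^ k * G (8 ^ Suc k)))" by (rule summable_mult)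
    then have "summable (\<lambda>k. 64 ^ Suc k * G (8 ^ Suc k))" by (simp add: mult.assoc)
    then have "summable (\<lambda>k. 64 ^ k * G (8 ^ k))" by (subst (asm) summable_Suc_iff)
    then have "summable (\<lambda>n. real n * G n)"
      using nonneg anti by (intro summable_condensation_8)
    then show False using div by blast
  qed
  have "\<not> summable (\<lambda>k. iid.prob (E k))"
  proof
    assume P: "summable (\<lambda>k. iid.prob (E k))"
    have "summable (\<lambda>k. 1 / C * iid.prob (E k) + (1 / 8) ^ k)"
      by (intro summable_add summable_mult P summable_geometric) auto
    then have "summable T"
    proof (rule summable_comparison_test'[where N = A])
      fix k assume k: "A \<le> k"
      have "T k \<le> 1 / C * iid.prob (E k) + (1 / 8) ^ k"
      proof (cases "good k")
        case True
        then have "T k \<le> 1 / C * iid.prob (E k)" using low[OF True] C by (simp add: field_simps)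
        then show ?thesis by (simp add: add_increasing2)
      next
        case False
        then have "T k \<le> (1 / 8) ^ k" using k by (simp add: good_def)
        then show ?thesis using C by (simp add: add_increasing)
      qed
      then show "norm (T k) \<le> 1 / C * iid.prob (E k) + (1 / 8) ^ k" using \<epsilon>[of k] by (simp add: T_def)
    qed
    then show False using \<open>\<not> summable T\<close> by blast
  qed
  then have "AE z in iid. infinite {k. z \<in> E k}"
    by (intro borel_cantelli_determined[where V = "\<lambda>k. {8 ^ k..<8 ^ Suc k}"] disj det) auto
  then show ?thesis
  proof (rule AE_mp, intro AE_I2 impI)
    fix z assume inf: "infinite {k. z \<in> E k}"
    show "infinite {k. \<exists>l n m. 8 ^ k \<le> l \<and> l < n \<and> l + m \<le> n \<and> n \<le> 8 ^ Suc k \<and> 0 < G (8 ^ Suc k)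
      \<and> wt z l m \<le> G (8 ^ Suc k) \<and> (\<forall>a<m. z (n + a) = z (l + a))}"
    proof (rule infinite_super[OF _ inf], safe)
      fix k assume "z \<in> E k"
      then have g: "good k" and "\<exists>(l, n)\<in>{8 ^ k..<2 * 8 ^ k} \<times> {3 * 8 ^ k..<4 * 8 ^ k}. z \<in> repetition (A * k) (\<epsilon> k) l n"
        by (auto simp: E_def split: if_splits)
      then obtain l n m where *: "8 ^ k \<le> l" "l < 2 * 8 ^ k" "3 * 8 ^ k \<le> n" "n < 4 * 8 ^ k" "m \<le> A * k"
        "wt z l m \<le> \<epsilon> k" "\<forall>a<m. z (n + a) = z (l + a)"
        by (auto simp: repetition_def)
      \<comment> \<open>\<open>good k\<close> bounds \<open>T k\<close> below by a positive number;
        this is what makes \<open>G (8 ^ Suc k)\<close> positive.\<close>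
      have "0 < \<epsilon> k"
      proof (rule ccontr)
        assume "\<not> 0 < \<epsilon> k"
        then have "T k \<le> 0" by (simp add: T_def mult_le_0_iff)
        moreover have "(0::real) < (1 / 8) ^ k" by simp
        ultimately show False using g unfolding good_def by linarith
      qed
      moreover have "\<epsilon> k \<le> G (8 ^ Suc k)" by (simp add: \<epsilon>_def)
      ultimately show "\<exists>l n m. 8 ^ k \<le> l \<and> l < n \<and> l + m \<le> n \<and> n \<le> 8 ^ Suc k \<and> 0 < G (8 ^ Suc k)
        \<and> wt z l m \<le> G (8 ^ Suc k) \<and> (\<forall>a<m. z (n + a) = z (l + a))"
        using * AL[of k] g by (intro exI[of _ l] exI[of _ n] exI[of _ m]) (auto simp: good_def)
    qed
  qed
qed

end

section \<open>The code map\<close>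

lemma diameter_similarity:
  fixes f :: "'b::real_normed_vector \<Rightarrow> 'c::real_normed_vector"
  assumes "bounded S" "S \<noteq> {}" "0 < c" "\<And>x y. dist (f x) (f y) = c * dist x y"
  shows "diameter (f ` S) = c * diameter S"
proof (rule antisym)
  show "diameter (f ` S) \<le> c * diameter S"
    using assms by (intro diameter_le) (auto intro!: mult_left_mono diameter_bounded_bound simp flip: dist_norm)
  have bf: "bounded (f ` S)"
  proof -
    obtain x e where "\<forall>y\<in>S. dist x y \<le> e" using assms(1) by (auto simp: bounded_def)
    then have "\<forall>y\<in>S. dist (f x) (f y) \<le> c * e" using assms by simp
    then show ?thesis unfolding bounded_def by blast
  qed
  have "diameter S \<le> diameter (f ` S) / c"
  proof (rule diameter_le)
    fix x y assume "x \<in> S" "y \<in> S"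
    then have "c * dist x y \<le> diameter (f ` S)"
      using diameter_bounded_bound[OF bf, of "f x" "f y"] assms by simp
    then show "norm (x - y) \<le> diameter (f ` S) / c" using assms by (simp add: dist_norm field_simps)
  qed (use assms in auto)
  then show "c * diameter S \<le> diameter (f ` S)" using assms by (simp add: field_simps)
qed

section \<open>Shifts and eventually periodic sequences\<close>

definition shift :: "nat \<Rightarrow> (nat \<Rightarrow> 'a) \<Rightarrow> nat \<Rightarrow> 'a" where
  "shift n \<omega> j = \<omega> (n + j)"

lemma shift_0 [simp]: "shift 0 \<omega> = \<omega>"
  by (simp add: shift_def fun_eq_iff)

lemma shift_shift: "shift m (shift n \<omega>) = shift (n + m) \<omega>"
  by (simp add: shift_def fun_eq_iff add.assoc)

lemma periodize_cong: "l < n \<Longrightarrow> (\<And>j. j < n \<Longrightarrow> \<omega> j = \<omega>' j) \<Longrightarrow> periodize l n \<omega> = periodize l n \<omega>'"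
proof
  fix j assume ln: "l < n" and eq: "\<And>j. j < n \<Longrightarrow> \<omega> j = \<omega>' j"
  have "(j - l) mod (n - l) < n - l" using ln by simp
  then have "l + (j - l) mod (n - l) < n" by linarith
  then show "periodize l n \<omega> j = periodize l n \<omega>' j" using ln by (simp add: periodize_def eq)
qed

lemma periodize_prefix: "j < n \<Longrightarrow> periodize l n \<omega> j = \<omega> j"
  by (simp add: periodize_def)

lemma periodize_idem: "l < n \<Longrightarrow> periodize l n (periodize l n \<omega>) = periodize l n \<omega>"
  by (rule periodize_cong) (auto simp: periodize_prefix)

lemma shift_periodize: "l < n \<Longrightarrow> shift n (periodize l n \<omega>) = shift l (periodize l n \<omega>)"
  by (auto simp: fun_eq_iff shift_def periodize_def mod_if[of "n + _ - l"])

text \<open>Converse of \<open>shift_periodize\<close>: a strong induction removes one period at a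
  time from the index.\<close>

lemma periodize_eqI:
  assumes "l < n" "shift n \<omega> = shift l \<omega>"
  shows "periodize l n \<omega> = \<omega>"
proof -
  have *: "\<omega> (l + j) = \<omega> (l + j mod (n - l))" for j
  proof (induction j rule: less_induct)
    case (less j)
    show ?case
    proof (cases "j < n - l")
      case False
      then have "n + (j - (n - l)) = l + j" using assms(1) by simp
      then have "\<omega> (l + j) = \<omega> (l + (j - (n - l)))"
        using fun_cong[OF assms(2), of "j - (n - l)"] unfolding shift_def by metis
      also have "\<dots> = \<omega> (l + (j - (n - l)) mod (n - l))" using less[of "j - (n - l)"] False assms(1) by simp
      also have "(j - (n - l)) mod (n - l) = j mod (n - l)" using False by (simp add: le_mod_geq)
      finally show ?thesis .
    qed simp
  qed
  show ?thesis
  proof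
    fix j show "periodize l n \<omega> j = \<omega> j"
      using *[of "j - l", symmetric] by (cases "j < l") (simp_all add: periodize_def)
  qed
qed

section \<open>The self-similar set as the image of the sequence space\<close>

locale integer_ifs =
  fixes t :: "'a::finite \<Rightarrow> int ^ 'd" and q :: "'a \<Rightarrow> int"
  assumes q_ge_2: "\<And>a. 2 \<le> \<bar>q a\<bar>"
begin

abbreviation "f \<equiv> ifs_map t q"
abbreviation "code \<equiv> code_map t q"
abbreviation "X \<equiv> self_similar_set t q"

definition transl :: "'a \<Rightarrow> real ^ 'd" where
  "transl a = (\<chi> i. of_int (t a $ i))"

definition ratio :: "'a list \<Rightarrow> real" where
  "ratio w = (\<Prod>a\<leftarrow>w. 1 / real_of_int \<bar>q a\<bar>)"

lemma q_nonzero [simp]: "q a \<noteq> 0"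
  using q_ge_2[of a] by auto

lemma ratio_simps [simp]: "ratio [] = 1" "ratio (a # w) = ratio w / real_of_int \<bar>q a\<bar>"
  "ratio (v @ w) = ratio v * ratio w"
  by (auto simp: ratio_def)

lemma ratio_pos: "0 < ratio w"
  by (induction w) auto

lemma ratio_le: "ratio w \<le> (1 / 2) ^ length w"
proof (induction w)
  case (Cons a w)
  have "ratio w / real_of_int \<bar>q a\<bar> \<le> (1 / 2) ^ length w / 2"
    using Cons q_ge_2[of a] ratio_pos[of w] by (intro frac_le) auto
  then show ?case by simp
qed simp

lemma ratio_map_upt: "ratio (map \<omega> [0..<n]) = 1 / (\<Prod>j<n. real_of_int \<bar>q (\<omega> j)\<bar>)"
  by (induction n) auto

lemma f_eq: "f a x = (1 / of_int (q a)) *\<^sub>R (x + transl a)"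
  by (simp add: ifs_map_def transl_def)

lemma dist_f: "dist (f a x) (f a y) = dist x y / real_of_int \<bar>q a\<bar>"
proof -
  have "f a x - f a y = (1 / of_int (q a)) *\<^sub>R (x - y)" by (simp add: f_eq scaleR_diff_right[symmetric])
  then show ?thesis by (simp add: dist_norm)
qed

lemma dist_foldr_f: "dist (foldr f w x) (foldr f w y) = ratio w * dist x y"
  by (induction w) (auto simp: dist_f)

definition M :: real where "M = Max (range (\<lambda>a. norm (transl a)))"

lemma norm_transl_le: "norm (transl a) \<le> M"
  unfolding M_def by (rule Max_ge) auto

lemma M_nonneg: "0 \<le> M"
  using norm_transl_le[of undefined] norm_ge_zero order_trans by blast

lemma code_eq: "code \<omega> = (\<Sum>n. (1 / of_int (\<Prod>j\<le>n. q (\<omega> j))) *\<^sub>R transl (\<omega> n))"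
  by (simp add: code_map_def transl_def)

lemma norm_code_term: "norm ((1 / of_int (\<Prod>j\<le>n. q (\<omega> j))) *\<^sub>R transl (\<omega> n)) \<le> M * (1 / 2) ^ Suc n"
proof -
  have "norm ((1 / of_int (\<Prod>j\<le>n. q (\<omega> j))) *\<^sub>R transl (\<omega> n)) = ratio (map \<omega> [0..<Suc n]) * norm (transl (\<omega> n))"
    unfolding ratio_map_upt by (simp add: abs_prod lessThan_Suc_atMost)
  also have "\<dots> \<le> (1 / 2) ^ Suc n * M"
    using ratio_le[of "map \<omega> [0..<Suc n]"] by (intro mult_mono norm_transl_le) auto
  finally show ?thesis by (simp add: mult.commute)
qed

lemma summable_code: "summable (\<lambda>n. (1 / of_int (\<Prod>j\<le>n. q (\<omega> j))) *\<^sub>R transl (\<omega> n))"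
proof (rule summable_comparison_test')
  show "summable (\<lambda>n. M * (1 / 2) ^ Suc n)" by (intro summable_mult) (simp add: summable_geometric)
qed (rule norm_code_term)

lemma norm_code_le: "norm (code \<omega>) \<le> M"
proof -
  have s: "(\<lambda>n. M * (1 / 2) ^ Suc n) sums (M * 1)" by (intro sums_mult power_half_series)
  have "norm (code \<omega>) \<le> (\<Sum>n. M * (1 / 2) ^ Suc n)"
    unfolding code_eq by (rule norm_suminf_le[OF norm_code_term sums_summable[OF s]])
  then show ?thesis using sums_unique[OF s] by simp
qed

lemma code_rec: "code \<omega> = f (\<omega> 0) (code (shift 1 \<omega>))"
proof -
  let ?h = "\<lambda>n. (1 / of_int (\<Prod>j\<le>n. q (\<omega> j))) *\<^sub>R transl (\<omega> n)"
  have "?h (Suc n) = (1 / of_int (q (\<omega> 0))) *\<^sub>R ((1 / of_int (\<Prod>j\<le>n. q (shift 1 \<omega> j))) *\<^sub>R transl (shift 1 \<omega> n))" for n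
    by (simp add: prod.atMost_Suc_shift shift_def del: prod.atMost_Suc)
  moreover have "code \<omega> = ?h 0 + (\<Sum>n. ?h (Suc n))"
    unfolding code_eq using suminf_split_head[OF summable_code[of \<omega>]] by simp
  moreover have "(\<Sum>n. (1 / of_int (q (\<omega> 0))) *\<^sub>R ((1 / of_int (\<Prod>j\<le>n. q (shift 1 \<omega> j))) *\<^sub>R transl (shift 1 \<omega> n)))
      = (1 / of_int (q (\<omega> 0))) *\<^sub>R code (shift 1 \<omega>)"
    unfolding code_eq by (rule suminf_scaleR_right[OF summable_code, symmetric])
  ultimately show ?thesis by (simp add: f_eq scaleR_add_right)
qed

lemma code_split: "code \<omega> = foldr f (map \<omega> [0..<n]) (code (shift n \<omega>))"
proof (induction n)
  case (Suc n)
  have "code (shift n \<omega>) = f (\<omega> n) (code (shift (Suc n) \<omega>))"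
    using code_rec[of "shift n \<omega>"] by (simp add: shift_shift) (simp add: shift_def)
  then show ?case using Suc by simp
qed simp

text \<open>The continuous image of a compact product of finite discrete spaces. The topology is
  written out because \<open>'a\<close> carries none.\<close>

lemma compact_range_code: "compact (range code)"
proof -
  let ?T = "product_topology (\<lambda>_::nat. discrete_topology (UNIV :: 'a set)) UNIV"
  have "compact_space ?T" by (auto simp: compact_space_product_topology compact_space_discrete_topology)
  moreover have top: "topspace ?T = UNIV" by (simp add: topspace_product_topology)
  moreover have "continuous_map ?T euclidean code"
    unfolding continuous_map_def
  proof (intro conjI allI impI)
    fix U :: "(real ^ 'd) set" assume "openin euclidean U"
    then have U: "open U" by simp
    show "openin ?T {\<omega> \<in> topspace ?T. code \<omega> \<in> U}"
    proof (subst openin_subopen, intro ballI)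
      fix \<omega> assume "\<omega> \<in> {\<omega> \<in> topspace ?T. code \<omega> \<in> U}"
      then obtain e where e: "0 < e" "ball (code \<omega>) e \<subseteq> U" using U by (auto simp: open_contains_ball)
      \<comment> \<open>Tails are at distance at most \<open>2 * M\<close>; the added 1 keeps the
        denominator positive.\<close>
      obtain n where "(1 / 2) ^ n < e / (2 * M + 1)"
        using real_arch_pow_inv[of "e / (2 * M + 1)" "1 / 2"] e M_nonneg by auto
      then have n: "(1 / 2) ^ n * (2 * M + 1) < e" using M_nonneg by (simp add: field_simps)
      let ?C = "PiE UNIV (\<lambda>j. if j < n then {\<omega> j} else UNIV)"
      have "openin ?T ?C"
      proof (rule product_topology_basis)
        show "finite {i. (if i < n then {\<omega> i} else UNIV) \<noteq> topspace (discrete_topology (UNIV :: 'a set))}"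
          by (rule finite_subset[of _ "{..<n}"]) auto
      qed auto
      moreover have "\<omega> \<in> ?C" by auto
      moreover have "code \<omega>' \<in> U" if "\<omega>' \<in> ?C" for \<omega>'
      proof -
        have "\<omega>' j = \<omega> j" if "j < n" for j using \<open>\<omega>' \<in> ?C\<close> that by (auto simp: PiE_def Pi_def split: if_splits)
        then have eq: "map \<omega>' [0..<n] = map \<omega> [0..<n]" by auto
        have "dist (code \<omega>) (code \<omega>') = ratio (map \<omega> [0..<n]) * dist (code (shift n \<omega>)) (code (shift n \<omega>'))"
          by (subst (1 2) code_split[where n = n]) (simp only: eq dist_foldr_f)
        also have "\<dots> \<le> (1 / 2) ^ n * (2 * M + 1)"
        proof (rule mult_mono)
          show "ratio (map \<omega> [0..<n]) \<le> (1 / 2) ^ n" using ratio_le[of "map \<omega> [0..<n]"] by simp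
          show "dist (code (shift n \<omega>)) (code (shift n \<omega>')) \<le> 2 * M + 1"
            using norm_triangle_ineq4[of "code (shift n \<omega>)" "code (shift n \<omega>')"]
              norm_code_le[of "shift n \<omega>"] norm_code_le[of "shift n \<omega>'"] by (simp add: dist_norm)
        qed auto
        finally show ?thesis using n e by auto
      qed
      ultimately show "\<exists>T. openin ?T T \<and> \<omega> \<in> T \<and> T \<subseteq> {\<omega> \<in> topspace ?T. code \<omega> \<in> U}"
        by (intro exI[of _ ?C]) (auto simp: top)
    qed
  qed auto
  ultimately have "compactin euclidean (code ` UNIV)"
    using image_compactin[of ?T UNIV euclidean code] by (simp add: compact_space_def)
  then show ?thesis by simp
qed

lemma foldr_f_in:
  "(\<And>a x. x \<in> K \<Longrightarrow> f a x \<in> K) \<Longrightarrow> x \<in> K \<Longrightarrow> foldr f w x \<in> K"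
  by (induction w) auto

lemma dist_foldr_code_le:
  assumes "dist y (code (shift n \<omega>)) \<le> B"
  shows "dist (foldr f (map \<omega> [0..<n]) y) (code \<omega>) \<le> (1 / 2) ^ n * B"
proof -
  have "dist (foldr f (map \<omega> [0..<n]) y) (code \<omega>) = ratio (map \<omega> [0..<n]) * dist y (code (shift n \<omega>))"
    by (subst code_split[where n = n]) (rule dist_foldr_f)
  also have "\<dots> \<le> (1 / 2) ^ n * B"
    using ratio_le[of "map \<omega> [0..<n]"] assms by (intro mult_mono) auto
  finally show ?thesis .
qed

text \<open>The description by \<open>THE\<close> asks for existence and uniqueness.
  \<open>code_rec\<close> makes \<open>range code\<close> a solution. For another solution
  \<open>K\<close>, pulling a point of \<open>K\<close> back through the maps for ever yields a
  coding of it; conversely, the images of one point of \<open>K\<close> under the prefixes of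
  \<open>\<omega>\<close> converge to \<open>code \<omega>\<close>, and \<open>K\<close> is
  closed.\<close>

lemma X_eq: "X = range code"
  unfolding self_similar_set_def
proof (rule the_equality)
  have "range code = (\<Union>a. f a ` range code)"
  proof safe
    fix \<omega> show "code \<omega> \<in> (\<Union>a. f a ` range code)" using code_rec[of \<omega>] by blast
  next
    fix a and \<omega> :: "nat \<Rightarrow> 'a"
    have "shift 1 (case_nat a \<omega>) = \<omega>" by (simp add: shift_def fun_eq_iff)
    then have "code (case_nat a \<omega>) = f a (code \<omega>)" using code_rec[of "case_nat a \<omega>"] by simp
    then show "f a (code \<omega>) \<in> range code" by (metis rangeI)
  qed
  then show "range code \<noteq> {} \<and> compact (range code) \<and> range code = (\<Union>a. f a ` range code)"
    using compact_range_code by blast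
next
  fix K assume "K \<noteq> {} \<and> compact K \<and> K = (\<Union>a. f a ` K)"
  then have K: "K \<noteq> {}" "compact K" "K = (\<Union>a. f a ` K)" by blast+
  have inK: "f a x \<in> K" if "x \<in> K" for a x using K(3) that by blast
  obtain C where C: "\<And>x. x \<in> K \<Longrightarrow> norm x \<le> C" using compact_imp_bounded[OF K(2)] by (auto simp: bounded_iff)
  have bd: "dist y (code \<omega>) \<le> C + M" if "y \<in> K" for y \<omega>
    using norm_triangle_ineq4[of y "code \<omega>"] C[OF that] norm_code_le[of \<omega>] by (simp add: dist_norm)
  have lim: "(\<lambda>n. (1 / 2) ^ n * (C + M)) \<longlonglongrightarrow> 0"
    by (intro tendsto_mult_left_zero LIMSEQ_power_zero) simp
  show "K = range code"
  proof (intro equalityI subsetI)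
    fix x assume x: "x \<in> K"
    have "\<forall>y\<in>K. \<exists>a. \<exists>y'\<in>K. y = f a y'" using K(3) by blast
    then obtain a b where ab: "\<And>y. y \<in> K \<Longrightarrow> b y \<in> K \<and> y = f (a y) (b y)" by metis
    define \<omega> where "\<omega> n = a ((b ^^ n) x)" for n
    have bK: "(b ^^ n) x \<in> K" for n by (induction n) (use x ab in auto)
    have "foldr f (map \<omega> [0..<n]) ((b ^^ n) x) = x" for n
    proof (induction n)
      case (Suc n)
      have "f (\<omega> n) ((b ^^ Suc n) x) = (b ^^ n) x" using ab[OF bK[of n]] by (simp add: \<omega>_def)
      then show ?case using Suc by simp
    qed simp
    then have "dist x (code \<omega>) \<le> (1 / 2) ^ n * (C + M)" for n
      using dist_foldr_code_le[of "(b ^^ n) x" n \<omega> "C + M"] bd[OF bK[of n]] by simp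
    then have "dist x (code \<omega>) \<le> 0" using lim by (intro LIMSEQ_le_const[OF lim]) auto
    then show "x \<in> range code" by simp
  next
    fix x assume "x \<in> range code"
    then obtain \<omega> where x: "x = code \<omega>" by auto
    obtain y where y: "y \<in> K" using K(1) by auto
    have "(\<lambda>n. foldr f (map \<omega> [0..<n]) y) \<longlonglongrightarrow> x"
    proof (rule metric_LIMSEQ_I)
      fix e :: real assume "0 < e"
      then have "\<forall>\<^sub>F n in sequentially. (1 / 2) ^ n * (C + M) < e" using order_tendstoD(2)[OF lim] by simp
      then obtain N where "\<And>n. N \<le> n \<Longrightarrow> (1 / 2) ^ n * (C + M) < e" by (auto simp: eventually_sequentially)
      then show "\<exists>N. \<forall>n\<ge>N. dist (foldr f (map \<omega> [0..<n]) y) x < e"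
        using dist_foldr_code_le[OF bd[OF y]] unfolding x by (meson le_less_trans)
    qed
    moreover have "foldr f (map \<omega> [0..<n]) y \<in> K" for n using foldr_f_in[of K, OF inK] y by blast
    ultimately show "x \<in> K" by (rule closed_sequentially[OF compact_imp_closed[OF K(2)], rotated])
  qed
qed

lemma bounded_X: "bounded X"
  using compact_range_code by (simp add: X_eq compact_imp_bounded)

lemma X_nonempty: "X \<noteq> {}"
  by (simp add: X_eq)

lemma diameter_X_nonneg: "0 \<le> diameter X"
  by (rule diameter_ge_0[OF bounded_X])

lemma diameter_cylinder: "diameter (cylinder t q w) = ratio w * diameter X"
  unfolding cylinder_def
  by (rule diameter_similarity[OF bounded_X X_nonempty ratio_pos dist_foldr_f])

lemma dist_code_le:
  assumes "\<And>j. j < n \<Longrightarrow> \<omega> j = \<omega>' j"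
  shows "dist (code \<omega>) (code \<omega>') \<le> ratio (map \<omega> [0..<n]) * diameter X"
proof -
  have eq: "map \<omega>' [0..<n] = map \<omega> [0..<n]" using assms by auto
  have "dist (code \<omega>) (code \<omega>') = ratio (map \<omega> [0..<n]) * dist (code (shift n \<omega>)) (code (shift n \<omega>'))"
    by (subst (1 2) code_split[where n = n]) (simp only: eq dist_foldr_f)
  also have "\<dots> \<le> ratio (map \<omega> [0..<n]) * diameter X"
    by (intro mult_left_mono diameter_bounded_bound bounded_X) (auto simp: X_eq less_imp_le[OF ratio_pos])
  finally show ?thesis .
qed

text \<open>The rational translation part is what carries rationality from fixed points of words to
  all eventually periodic codings.\<close>

lemma foldr_f_affine:
  "\<exists>v. (\<forall>i. v $ i \<in> \<rat>) \<and> (\<forall>x. foldr f w x = (1 / of_int (\<Prod>a\<leftarrow>w. q a)) *\<^sub>R x + v)"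
proof (induction w)
  case Nil
  show ?case by (rule exI[of _ 0]) simp
next
  case (Cons a w)
  then obtain v where v: "\<And>i. v $ i \<in> \<rat>" "\<And>x. foldr f w x = (1 / of_int (\<Prod>a\<leftarrow>w. q a)) *\<^sub>R x + v" by auto
  show ?case
  proof (intro exI conjI allI)
    show "foldr f (a # w) x = (1 / of_int (\<Prod>a\<leftarrow>a # w. q a)) *\<^sub>R x + (1 / of_int (q a)) *\<^sub>R (v + transl a)" for x
      by (simp add: v f_eq scaleR_add_right add.assoc)
    show "((1 / of_int (q a)) *\<^sub>R (v + transl a)) $ i \<in> \<rat>" for i
      using v(1)[of i] by (simp add: transl_def)
  qed
qed

lemma prod_list_q_ge_2: "w \<noteq> [] \<Longrightarrow> 2 \<le> \<bar>\<Prod>a\<leftarrow>w. q a\<bar>"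
proof (induction w)
  case (Cons a w)
  have "1 \<le> \<bar>\<Prod>a\<leftarrow>w. q a\<bar>" using Cons by (cases "w = []") auto
  then have "2 * 1 \<le> \<bar>q a\<bar> * \<bar>\<Prod>a\<leftarrow>w. q a\<bar>" using q_ge_2[of a] by (intro mult_mono) auto
  then show ?case by (simp add: abs_mult)
qed simp

text \<open>The periodic tail codes a fixed point of \<open>x / Q + u\<close> with rational
  \<open>u\<close> and \<open>\<bar>Q\<bar> \<ge> 2\<close>, that is \<open>Q * u / (Q - 1)\<close>;
  the prefix acts by an affine map with rational coefficients.\<close>

lemma code_periodize_rational:
  assumes "l < n"
  shows "code (periodize l n \<omega>) \<in> rational_points t q"
proof -
  define \<omega>' where "\<omega>' = periodize l n \<omega>"
  define v where "v = code (shift l \<omega>')"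
  let ?w = "map (shift l \<omega>') [0..<n - l]"
  have v: "v = foldr f ?w v"
    using code_split[of "shift l \<omega>'" "n - l"] shift_periodize[OF assms, of \<omega>] assms
    by (simp add: shift_shift v_def \<omega>'_def)
  obtain u where u: "\<And>i. u $ i \<in> \<rat>" "\<And>x. foldr f ?w x = (1 / of_int (\<Prod>a\<leftarrow>?w. q a)) *\<^sub>R x + u"
    using foldr_f_affine[of ?w] by auto
  define Q where "Q = (\<Prod>a\<leftarrow>?w. q a)"
  have Q: "2 \<le> \<bar>Q\<bar>" unfolding Q_def by (rule prod_list_q_ge_2) (use assms in simp)
  have vi: "v $ i \<in> \<rat>" for i
  proof -
    have "v $ i = (1 / of_int Q) * v $ i + u $ i"
      using arg_cong[OF v, of "\<lambda>x. x $ i"] u(2)[of v] by (simp add: Q_def)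
    moreover have "real_of_int Q \<noteq> 1" "real_of_int Q \<noteq> 0" using Q by auto
    ultimately have "v $ i = of_int Q * u $ i / (of_int Q - 1)" by (simp add: field_simps)
    then show ?thesis using u(1)[of i] by simp
  qed
  obtain u' where u': "\<And>i. u' $ i \<in> \<rat>"
    "\<And>x. foldr f (map \<omega>' [0..<l]) x = (1 / of_int (\<Prod>a\<leftarrow>map \<omega>' [0..<l]. q a)) *\<^sub>R x + u'"
    using foldr_f_affine[of "map \<omega>' [0..<l]"] by auto
  have "code \<omega>' = (1 / of_int (\<Prod>a\<leftarrow>map \<omega>' [0..<l]. q a)) *\<^sub>R v + u'"
    using code_split[of \<omega>' l] u'(2) by (simp add: v_def)
  then have "code \<omega>' $ i \<in> \<rat>" for i using vi[of i] u'(1)[of i] by simp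
  then show ?thesis by (simp add: rational_points_def X_eq \<omega>'_def)
qed

end

section \<open>Rational points, their codings and their denominators\<close>

lemma finite_bounded_denominator:
  "finite {x :: real ^ 'n. \<forall>i. real d * x $ i \<in> \<int> \<and> \<bar>real d * x $ i\<bar> \<le> B}" (is "finite ?S") if "0 < d"
proof (rule finite_subset)
  show "?S \<subseteq> (\<lambda>h. \<chi> i. of_int (h i) / real d) ` (PiE UNIV (\<lambda>_. {- \<lfloor>B\<rfloor>..\<lfloor>B\<rfloor>}))"
  proof
    fix x assume x: "x \<in> ?S"
    have "real_of_int \<lfloor>real d * x $ i\<rfloor> = real d * x $ i" for i
    proof -
      have "real d * x $ i \<in> \<int>" using x by simp
      then show ?thesis by (elim Ints_cases) simp
    qed
    moreover from this have "\<lfloor>real d * x $ i\<rfloor> \<in> {- \<lfloor>B\<rfloor>..\<lfloor>B\<rfloor>}" for i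
    proof -
      have "\<bar>real_of_int \<lfloor>real d * x $ i\<rfloor>\<bar> \<le> B" using x calculation by simp
      then have "\<bar>\<lfloor>real d * x $ i\<rfloor>\<bar> \<le> \<lfloor>B\<rfloor>" by (simp add: le_floor_iff)
      then show ?thesis by auto
    qed
    moreover from calculation(1) have "x $ i = real_of_int \<lfloor>real d * x $ i\<rfloor> / real d" for i
      using that by (simp only: nonzero_eq_divide_eq of_nat_0_eq_iff) (simp add: mult.commute)
    ultimately show "x \<in> (\<lambda>h. \<chi> i. of_int (h i) / real d) ` (PiE UNIV (\<lambda>_. {- \<lfloor>B\<rfloor>..\<lfloor>B\<rfloor>}))"
      by (intro image_eqI[of _ _ "\<lambda>i. \<lfloor>real d * x $ i\<rfloor>"]) (auto simp: vec_eq_iff)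
  qed
qed (intro finite_imageI finite_PiE; simp)

lemma common_denominator:
  fixes x :: "real ^ 'n"
  assumes "\<And>i. x $ i \<in> \<rat>"
  obtains d :: nat where "0 < d" "\<And>i. real d * x $ i \<in> \<int>"
proof -
  have "\<exists>d::nat. 0 < d \<and> real d * x $ i \<in> \<int>" for i
  proof -
    obtain a b :: int where "0 < b" "x $ i = of_int a / of_int b" using assms[of i] by (meson Rats_cases')
    then have "real (nat b) * x $ i = of_int a" by simp
    then show ?thesis using \<open>0 < b\<close> by (intro exI[of _ "nat b"]) auto
  qed
  then obtain d where d: "\<And>i. (0::nat) < d i" "\<And>i. real (d i) * x $ i \<in> \<int>" by metis
  have "real (\<Prod>j\<in>UNIV. d j) * x $ i \<in> \<int>" for i
  proof -
    have "real (\<Prod>j\<in>UNIV. d j) * x $ i = real (\<Prod>j\<in>UNIV - {i}. d j) * (real (d i) * x $ i)"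
      by (subst prod.remove[of UNIV i]) auto
    then show ?thesis using d(2)[of i] by (metis Ints_mult Ints_of_nat)
  qed
  then show thesis using d(1) by (intro that[of "\<Prod>j\<in>UNIV. d j"]) (auto intro: prod_pos)
qed

locale separated_ifs = integer_ifs t q
  for t :: "'a::finite \<Rightarrow> int ^ 'd" and q :: "'a \<Rightarrow> int" +
  assumes separated: "strong_separation t q"
begin

text \<open>Strong separation reads the first letter off the point, and injectivity of the map of
  that letter passes the equality on to the shifted sequences.\<close>

lemma inj_code: "inj code"
proof (rule injI)
  fix \<omega> \<omega>' assume eq: "code \<omega> = code \<omega>'"
  have *: "(\<forall>j<n. \<omega> j = \<omega>' j) \<and> code (shift n \<omega>) = code (shift n \<omega>')" for n
  proof (induction n)
    case (Suc n)
    have rec: "code (shift n u) = f (u n) (code (shift (Suc n) u))" for u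
      using code_rec[of "shift n u"] by (simp add: shift_shift) (simp add: shift_def)
    have "\<omega> n = \<omega>' n"
    proof (rule ccontr)
      assume "\<omega> n \<noteq> \<omega>' n"
      then have "f (\<omega> n) ` X \<inter> f (\<omega>' n) ` X = {}" using separated by (simp add: strong_separation_def)
      moreover have "code (shift n u) \<in> f (u n) ` X" for u using rec[of u] by (simp add: X_eq)
      from this[of \<omega>] this[of \<omega>'] have "code (shift n \<omega>) \<in> f (\<omega> n) ` X" "code (shift n \<omega>) \<in> f (\<omega>' n) ` X"
        using Suc by auto
      ultimately show False by blast
    qed
    moreover have "code (shift (Suc n) \<omega>) = code (shift (Suc n) \<omega>')"
      using rec[of \<omega>] rec[of \<omega>'] Suc \<open>\<omega> n = \<omega>' n\<close> dist_f[of "\<omega> n" "code (shift (Suc n) \<omega>)" "code (shift (Suc n) \<omega>')"]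
      by simp
    ultimately show ?case using Suc by (auto simp: less_Suc_eq)
  qed (simp add: eq)
  then show "\<omega> = \<omega>'" by (meson ext lessI)
qed

lemma coding_code [simp]: "coding t q (code \<omega>) = \<omega>"
  unfolding coding_def using inj_code by (auto dest: injD)

lemma code_coding: "x \<in> X \<Longrightarrow> code (coding t q x) = x"
  by (auto simp: X_eq)

lemma eq_code_periodize_iff:
  "x \<in> X \<Longrightarrow> x = code (periodize l n (coding t q x)) \<longleftrightarrow> coding t q x = periodize l n (coding t q x)"
  by (metis code_coding coding_code)

text \<open>If \<open>d\<close> clears the denominators of \<open>x\<close>, it clears those of all
  shifted points, because undoing a map is \<open>y \<mapsto> q * y - t\<close> with integer data.
  These points are bounded by \<open>M\<close>, so there are finitely many, two of them agree, and
  \<open>inj_code\<close> makes the corresponding tails equal.\<close>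

lemma rational_eventually_periodic:
  assumes "x \<in> rational_points t q"
  shows "\<exists>l n. l < n \<and> coding t q x = periodize l n (coding t q x)"
proof -
  have x: "x \<in> X" "\<And>i. x $ i \<in> \<rat>" using assms by (auto simp: rational_points_def)
  define \<omega> where "\<omega> = coding t q x"
  have code: "code \<omega> = x" using code_coding[OF x(1)] by (simp add: \<omega>_def)
  obtain d :: nat where d: "0 < d" "\<And>i. real d * x $ i \<in> \<int>" using common_denominator[OF x(2)] by blast
  have int: "real d * code (shift n \<omega>) $ i \<in> \<int>" for n i
  proof (induction n)
    case 0
    then show ?case using d(2) code by simp
  next
    case (Suc n)
    have "code (shift n \<omega>) = f (\<omega> n) (code (shift (Suc n) \<omega>))"
      using code_rec[of "shift n \<omega>"] by (simp add: shift_shift) (simp add: shift_def)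
    then have "code (shift (Suc n) \<omega>) $ i = of_int (q (\<omega> n)) * code (shift n \<omega>) $ i - of_int (t (\<omega> n) $ i)"
      by (simp add: ifs_map_def)
    then have "real d * code (shift (Suc n) \<omega>) $ i
      = of_int (q (\<omega> n)) * (real d * code (shift n \<omega>) $ i) - real d * of_int (t (\<omega> n) $ i)"
      by (simp only: right_diff_distrib mult.left_commute)
    then show ?case using Suc by simp
  qed
  have bound: "\<bar>real d * code u $ i\<bar> \<le> real d * M" for u i
    using component_le_norm_cart[of "code u" i] norm_code_le[of u] by (simp add: abs_mult mult_left_mono)
  have "range (\<lambda>n. code (shift n \<omega>)) \<subseteq> {x. \<forall>i. real d * x $ i \<in> \<int> \<and> \<bar>real d * x $ i\<bar> \<le> real d * M}"
    using int bound by auto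
  then have "finite (range (\<lambda>n. code (shift n \<omega>)))"
    using finite_bounded_denominator[OF d(1)] by (rule finite_subset)
  then have "\<not> inj (\<lambda>n. code (shift n \<omega>))" using finite_imageD[of _ UNIV] infinite_UNIV_nat by blast
  then obtain l n where "l < n" "code (shift n \<omega>) = code (shift l \<omega>)"
    unfolding inj_def by (metis linorder_neqE_nat)
  then have "periodize l n \<omega> = \<omega>" using injD[OF inj_code] by (intro periodize_eqI) auto
  then show ?thesis using \<open>l < n\<close> unfolding \<omega>_def by metis
qed

lemma n_int_le:
  assumes "x \<in> X" "l < n" "coding t q x = periodize l n (coding t q x)"
  shows "n_int t q x \<le> n"
  unfolding n_int_def using assms eq_code_periodize_iff[OF assms(1)] by (intro cInf_lower) auto

lemma n_int_attained:
  assumes "x \<in> rational_points t q"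
  obtains l where "l < n_int t q x" "coding t q x = periodize l (n_int t q x) (coding t q x)"
proof -
  have x: "x \<in> X" using assms by (auto simp: rational_points_def)
  let ?S = "{n. \<exists>l<n. x = code (periodize l n (coding t q x))}"
  have "?S \<noteq> {}" using rational_eventually_periodic[OF assms] eq_code_periodize_iff[OF x] by blast
  then have "n_int t q x \<in> ?S" unfolding n_int_def by (rule Inf_nat_def1)
  then show thesis using that eq_code_periodize_iff[OF x] by auto
qed

text \<open>With \<open>Q\<close> the product over the period, \<open>\<bar>Q\<bar> \<ge> 2\<close>
  gives \<open>\<bar>Q\<bar> / 2 \<le> \<bar>Q - 1\<bar> \<le> 3 / 2 * \<bar>Q\<bar>\<close>; the
  extreme cases are \<open>Q = 2\<close> and \<open>Q = -2\<close>. Up to constants the denominator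
  thus depends on the word alone and not on \<open>l\<close>.\<close>

lemma denominator_bounds:
  fixes \<omega> :: "nat \<Rightarrow> 'a"
  assumes "l < n"
  shows "\<bar>(\<Prod>j<l. q (\<omega> j)) * ((\<Prod>j=l..<n. q (\<omega> j)) - 1)\<bar> \<ge> (\<Prod>j<n. real_of_int \<bar>q (\<omega> j)\<bar>) / 2" (is ?lower)
    and "\<bar>(\<Prod>j<l. q (\<omega> j)) * ((\<Prod>j=l..<n. q (\<omega> j)) - 1)\<bar> \<le> 3 / 2 * (\<Prod>j<n. real_of_int \<bar>q (\<omega> j)\<bar>)" (is ?upper)
proof -
  define Q where "Q = (\<Prod>j=l..<n. q (\<omega> j))"
  have eq: "(\<Prod>j<n. real_of_int \<bar>q (\<omega> j)\<bar>) = \<bar>real_of_int (\<Prod>j<l. q (\<omega> j))\<bar> * \<bar>of_int Q\<bar>"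
  proof -
    have "(\<Prod>j<n. real_of_int \<bar>q (\<omega> j)\<bar>) = (\<Prod>j<l. real_of_int \<bar>q (\<omega> j)\<bar>) * (\<Prod>j=l..<n. real_of_int \<bar>q (\<omega> j)\<bar>)"
      using prod.atLeastLessThan_concat[of 0 l n "\<lambda>j. real_of_int \<bar>q (\<omega> j)\<bar>"] assms by (simp add: lessThan_atLeast0)
    then show ?thesis by (simp add: Q_def abs_prod)
  qed
  have "2 \<le> \<bar>Q\<bar>"
  proof -
    have "(\<Prod>j=l..<n. q (\<omega> j)) = (\<Prod>a\<leftarrow>map \<omega> [l..<n]. q a)"
      by (simp add: prod.distinct_set_conv_list[symmetric] comp_def)
    then show ?thesis unfolding Q_def using assms prod_list_q_ge_2[of "map \<omega> [l..<n]"] by simp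
  qed
  then have Q: "\<bar>real_of_int Q\<bar> / 2 \<le> \<bar>of_int Q - 1\<bar>" "\<bar>real_of_int Q - 1\<bar> \<le> 3 / 2 * \<bar>of_int Q\<bar>"
    by (auto simp: abs_if split: if_splits)
  show ?lower using mult_left_mono[OF Q(1), of "\<bar>real_of_int (\<Prod>j<l. q (\<omega> j))\<bar>"]
    unfolding eq by (simp add: abs_mult Q_def)
  show ?upper using mult_left_mono[OF Q(2), of "\<bar>real_of_int (\<Prod>j<l. q (\<omega> j))\<bar>"]
    unfolding eq by (simp add: abs_mult Q_def mult_ac)
qed

lemma prod_q_mono:
  fixes \<omega> :: "nat \<Rightarrow> 'a"
  shows "m \<le> n \<Longrightarrow> (\<Prod>j<m. real_of_int \<bar>q (\<omega> j)\<bar>) \<le> (\<Prod>j<n. real_of_int \<bar>q (\<omega> j)\<bar>)"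
proof (rule lift_Suc_mono_le[of "\<lambda>n. \<Prod>j<n. real_of_int \<bar>q (\<omega> j)\<bar>"])
  fix n
  have "(\<Prod>j<n. real_of_int \<bar>q (\<omega> j)\<bar>) * 1 \<le> (\<Prod>j<n. real_of_int \<bar>q (\<omega> j)\<bar>) * real_of_int \<bar>q (\<omega> n)\<bar>"
    using q_ge_2[of "\<omega> n"] by (intro mult_left_mono prod_nonneg) auto
  then show "(\<Prod>j<n. real_of_int \<bar>q (\<omega> j)\<bar>) \<le> (\<Prod>j<Suc n. real_of_int \<bar>q (\<omega> j)\<bar>)" by simp
qed

text \<open>The infimum in \<open>q_int\<close> need not come from a representation with
  \<open>n = n_int t q x\<close>. Every admissible \<open>n\<close> is at least
  \<open>n_int t q x\<close>, though, and the products of the \<open>\<bar>q a\<bar>\<close> grow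
  with \<open>n\<close>.\<close>

lemma q_int_ge:
  assumes "x \<in> rational_points t q"
  shows "(\<Prod>j<n_int t q x. real_of_int \<bar>q (coding t q x j)\<bar>) / 2 \<le> q_int t q x"
  unfolding q_int_def
proof (rule cInf_greatest)
  have x: "x \<in> X" using assms by (auto simp: rational_points_def)
  show "{real_of_int \<bar>(\<Prod>j<l. q (coding t q x j)) * ((\<Prod>j=l..<n. q (coding t q x j)) - 1)\<bar> |l n.
      l < n \<and> x = code (periodize l n (coding t q x))} \<noteq> {}"
    using rational_eventually_periodic[OF assms] eq_code_periodize_iff[OF x] by blast
  fix y
  assume "y \<in> {real_of_int \<bar>(\<Prod>j<l. q (coding t q x j)) * ((\<Prod>j=l..<n. q (coding t q x j)) - 1)\<bar> |l n.
      l < n \<and> x = code (periodize l n (coding t q x))}"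
  then obtain l n where ln: "l < n" "x = code (periodize l n (coding t q x))"
    and y: "y = real_of_int \<bar>(\<Prod>j<l. q (coding t q x j)) * ((\<Prod>j=l..<n. q (coding t q x j)) - 1)\<bar>" by blast
  have "n_int t q x \<le> n" using ln eq_code_periodize_iff[OF x] by (intro n_int_le[OF x ln(1)]) blast
  then show "(\<Prod>j<n_int t q x. real_of_int \<bar>q (coding t q x j)\<bar>) / 2 \<le> y"
    unfolding y using denominator_bounds(1)[OF ln(1), of "coding t q x"] prod_q_mono[of "n_int t q x" n "coding t q x"] by linarith
qed

lemma q_int_pos: "x \<in> rational_points t q \<Longrightarrow> 0 < q_int t q x"
  by (rule less_le_trans[OF _ q_int_ge]) (auto intro!: prod_pos)

lemma q_int_le:
  assumes "x \<in> X" "l < n" "coding t q x = periodize l n (coding t q x)"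
  shows "q_int t q x \<le> 3 / 2 * (\<Prod>j<n. real_of_int \<bar>q (coding t q x j)\<bar>)"
  unfolding q_int_def
proof (rule cInf_lower2)
  show "real_of_int \<bar>(\<Prod>j<l. q (coding t q x j)) * ((\<Prod>j=l..<n. q (coding t q x j)) - 1)\<bar>
    \<le> 3 / 2 * (\<Prod>j<n. real_of_int \<bar>q (coding t q x j)\<bar>)"
    using denominator_bounds(2)[OF assms(2)] by simp
qed (use assms eq_code_periodize_iff[OF assms(1)] in \<open>auto intro!: bdd_belowI[of _ 0]\<close>)

text \<open>A rational point is finite data: \<open>periodize\<close> reads only the first
  \<open>length w\<close> entries, so \<open>nth w\<close> may stand for an infinite sequence.
  Counting the pairs gives at most \<open>n\<close> points per word of length \<open>n\<close>, the
  factor \<open>n\<close> of the series.\<close>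

lemma rational_point_eq:
  assumes "x \<in> rational_points t q"
  obtains l w where "l < length w" "length w = n_int t q x" "x = code (periodize l (length w) (nth w))"
    "w = map (coding t q x) [0..<n_int t q x]"
proof -
  have x: "x \<in> X" using assms by (auto simp: rational_points_def)
  obtain l where l: "l < n_int t q x" "coding t q x = periodize l (n_int t q x) (coding t q x)"
    using n_int_attained[OF assms] .
  let ?w = "map (coding t q x) [0..<n_int t q x]"
  have "periodize l (n_int t q x) (coding t q x) = periodize l (n_int t q x) (nth ?w)"
    by (rule periodize_cong[OF l(1)]) simp
  then have "x = code (periodize l (length ?w) (nth ?w))" using l code_coding[OF x] by simp
  then show thesis using l by (intro that[of l ?w]) auto
qed

lemma countable_rational_points: "countable (rational_points t q)"
proof (rule countable_subset)
  show "rational_points t q \<subseteq> range (\<lambda>(l, w). code (periodize l (length w) (nth w)))"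
  proof
    fix x assume "x \<in> rational_points t q"
    then obtain l w where "x = code (periodize l (length w) (nth w))" using rational_point_eq by metis
    then show "x \<in> range (\<lambda>(l, w). code (periodize l (length w) (nth w)))" by auto
  qed
qed simp

end

section \<open>Convergence\<close>

lemma hausdorff_measure_eq_0I:
  assumes "\<And>\<delta> e. 0 < \<delta> \<Longrightarrow> 0 < e \<Longrightarrow> \<exists>U :: nat \<Rightarrow> 'm::metric_space set. E \<subseteq> (\<Union>i. U i)
    \<and> (\<forall>i. bounded (U i) \<and> diameter (U i) \<le> \<delta>) \<and> (\<Sum>i. hausdorff_weight s (U i)) \<le> ennreal e"
  shows "hausdorff_measure s E = 0"
proof -
  have "(INF U\<in>{U :: nat \<Rightarrow> 'm set. E \<subseteq> (\<Union>i. U i) \<and> (\<forall>i. bounded (U i) \<and> diameter (U i) \<le> \<delta>)}.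
      \<Sum>i. hausdorff_weight s (U i)) = 0" (is "?I = 0") if "0 < \<delta>" for \<delta>
  proof -
    have "?I \<le> 0 + ennreal e" if e: "0 < e" for e
    proof -
      obtain U :: "nat \<Rightarrow> 'm set" where U: "E \<subseteq> (\<Union>i. U i)" "\<forall>i. bounded (U i) \<and> diameter (U i) \<le> \<delta>"
        "(\<Sum>i. hausdorff_weight s (U i)) \<le> ennreal e"
        using assms[OF \<open>0 < \<delta>\<close> e] by blast
      then show ?thesis by (auto intro!: INF_lower2[of U])
    qed
    then have "?I \<le> 0" by (rule ennreal_le_epsilon)
    then show ?thesis by simp
  qed
  then show ?thesis unfolding hausdorff_measure_def by (intro antisym SUP_least) simp_all
qed

lemma hausdorff_measure_empty: "hausdorff_measure s {} = 0"
  by (rule hausdorff_measure_eq_0I, rule exI[of _ "\<lambda>_. {}"]) (simp add: hausdorff_weight_def)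

text \<open>Turns a cover indexed by any countable type into a sequence, as
  \<open>hausdorff_measure\<close> demands. The remaining indices get the empty set, whose weight is
  0 even for \<open>s = 0\<close>.\<close>

lemma countable_cover_sequence:
  fixes U :: "'i::countable \<Rightarrow> 'm::metric_space set"
  obtains V :: "nat \<Rightarrow> 'm set" where "(\<Union>i. V i) = (\<Union>i. U i)" "\<And>i. V i = {} \<or> V i \<in> range U"
    "(\<Sum>i. hausdorff_weight s (V i)) = (\<integral>\<^sup>+i. hausdorff_weight s (U i) \<partial>count_space UNIV)"
proof -
  define V where "V n = (if n \<in> range (to_nat :: 'i \<Rightarrow> nat) then U (from_nat n) else {})" for n
  have V: "V (to_nat i) = U i" for i by (simp add: V_def)
  have "(\<Sum>n. hausdorff_weight s (V n)) = (\<integral>\<^sup>+n. hausdorff_weight s (V n) \<partial>count_space UNIV)"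
    by (simp add: nn_integral_count_space_nat)
  also have "\<dots> = (\<integral>\<^sup>+n\<in>range (to_nat :: 'i \<Rightarrow> nat). hausdorff_weight s (V n) \<partial>count_space UNIV)"
    by (intro nn_integral_cong) (auto simp: V_def hausdorff_weight_def split: split_indicator)
  also have "\<dots> = (\<integral>\<^sup>+i. hausdorff_weight s (U i) \<partial>count_space UNIV)"
    using nn_integral_count_compose_inj[of "to_nat :: 'i \<Rightarrow> nat" UNIV "\<lambda>n. hausdorff_weight s (V n)"]
    by (simp add: V)
  finally have sum: "(\<Sum>n. hausdorff_weight s (V n)) = \<dots>" .
  show thesis
  proof (rule that[of V, OF _ _ sum])
    show "(\<Union>i. V i) = (\<Union>i. U i)"
    proof (intro equalityI subsetI)
      fix x assume "x \<in> (\<Union>i. U i)"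
      then obtain i where "x \<in> U i" by auto
      then show "x \<in> (\<Union>i. V i)" using V by (intro UN_I[of "to_nat i"]) auto
    qed (auto simp: V_def split: if_splits)
  qed (auto simp: V_def)
qed

lemma hausdorff_weight_ball_le:
  fixes x :: "'b::real_normed_vector"
  assumes "0 < s" "0 \<le> r"
  shows "hausdorff_weight s (ball x r) \<le> ennreal ((2 * r) powr s)"
proof -
  have "diameter (ball x r) \<le> 2 * r"
  proof (rule diameter_le)
    fix y z assume "y \<in> ball x r" "z \<in> ball x r"
    then show "norm (y - z) \<le> 2 * r"
      using dist_triangle[of y z x] by (simp add: dist_norm[symmetric] dist_commute)
  qed (use assms in auto)
  then show ?thesis using assms
    by (auto simp: hausdorff_weight_def intro!: ennreal_leI powr_mono2 diameter_ge_0)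
qed

lemma finite_lists_length: "finite {w :: 'a::finite list. length w = n}"
  using finite_lists_length_eq[of "UNIV :: 'a set" n] by simp

section \<open>The cover of the limsup set when the series converges\<close>

context separated_ifs
begin

lemma finite_n_int_less: "finite {x \<in> rational_points t q. n_int t q x < N}"
proof (rule finite_subset)
  show "{x \<in> rational_points t q. n_int t q x < N}
    \<subseteq> (\<lambda>(l, w). code (periodize l (length w) (nth w))) ` ({..N} \<times> {w. set w \<subseteq> UNIV \<and> length w \<le> N})"
  proof
    fix x assume x: "x \<in> {x \<in> rational_points t q. n_int t q x < N}"
    then have "x \<in> rational_points t q" "n_int t q x < N" by auto
    then obtain l and w :: "'a list" where lw: "l < length w" "length w = n_int t q x"
      and eq: "x = code (periodize l (length w) (nth w))" and "w = map (coding t q x) [0..<n_int t q x]"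
      using rational_point_eq by blast
    have "(l, w) \<in> {..N} \<times> {w. set w \<subseteq> UNIV \<and> length w \<le> N}" using lw \<open>n_int t q x < N\<close> by auto
    then show "x \<in> (\<lambda>(l, w). code (periodize l (length w) (nth w))) ` ({..N} \<times> {w. set w \<subseteq> UNIV \<and> length w \<le> N})"
      using eq by (intro image_eqI[of _ _ "(l, w)"]) (simp_all only: case_prod_conv)
  qed
  show "finite ((\<lambda>(l, w). code (periodize l (length w) (nth w))) ` ({..N} \<times> {w. set w \<subseteq> UNIV \<and> length w \<le> N}))"
    using finite_lists_length_le[of "UNIV :: 'a set" N] by (intro finite_imageI finite_cartesian_product) auto
qed

text \<open>Only finitely many rational points have \<open>n_int\<close> at most \<open>N\<close>,
  so one of the infinitely many approximations lies in the tail. The factor 2 comes from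
  \<open>q_int_ge\<close>. Positivity of \<open>g\<close> follows from the strict inequality with a
  norm on the left, and serves the case \<open>s = 0\<close>.\<close>

lemma W3_approx:
  assumes g: "\<forall>n\<ge>1. 0 \<le> g n" and x: "x \<in> W3 t q g"
  obtains k l w where "l < length w" "length w = Suc (k + N)" "0 < g (length w)"
    "x \<in> ball (code (periodize l (length w) (nth w))) (2 * g (length w) * ratio w)"
proof -
  let ?R = "{r \<in> rational_points t q. norm (x - r) < g (n_int t q r) / q_int t q r}"
  have "infinite ?R" using x by (simp add: W3_def)
  then have "infinite (?R - {r \<in> rational_points t q. n_int t q r < Suc N})"
    using finite_n_int_less by (intro Diff_infinite_finite)
  then have "?R - {r \<in> rational_points t q. n_int t q r < Suc N} \<noteq> {}" by (rule infinite_imp_nonempty)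
  then obtain r where "r \<in> ?R - {r \<in> rational_points t q. n_int t q r < Suc N}" by blast
  then have r: "r \<in> rational_points t q" "norm (x - r) < g (n_int t q r) / q_int t q r" "Suc N \<le> n_int t q r"
    by auto
  obtain l w where w: "l < length w" "length w = n_int t q r" "r = code (periodize l (length w) (nth w))"
    "w = map (coding t q r) [0..<n_int t q r]"
    using rational_point_eq[OF r(1)] .
  have pos: "0 < q_int t q r" using q_int_pos[OF r(1)] .
  have ratio: "ratio w = 1 / (\<Prod>j<n_int t q r. real_of_int \<bar>q (coding t q r j)\<bar>)"
    by (subst w(4)) (rule ratio_map_upt)
  have gn: "0 < g (n_int t q r)"
  proof -
    have "0 < g (n_int t q r) / q_int t q r" using r(2) norm_ge_zero[of "x - r"] by linarith
    then show ?thesis using pos by (simp add: zero_less_divide_iff)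
  qed
  have "g (n_int t q r) / q_int t q r
    \<le> g (n_int t q r) / ((\<Prod>j<n_int t q r. real_of_int \<bar>q (coding t q r j)\<bar>) / 2)"
    using gn by (intro divide_left_mono q_int_ge r(1)) (auto intro!: mult_pos_pos pos prod_pos)
  also have "\<dots> = 2 * g (n_int t q r) * ratio w" by (simp add: ratio)
  finally have "norm (x - r) < 2 * g (n_int t q r) * ratio w" using r(2) by simp
  then have ball: "x \<in> ball r (2 * g (n_int t q r) * ratio w)" by (simp add: dist_norm norm_minus_commute)
  show thesis
  proof (rule that[of l w "n_int t q r - Suc N"])
    show "length w = Suc (n_int t q r - Suc N + N)" using r(3) w(2) by simp
    show "0 < g (length w)" unfolding w(2) by (rule gn)
    show "x \<in> ball (code (periodize l (length w) (nth w))) (2 * g (length w) * ratio w)"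
      by (subst w(3)[symmetric], subst w(2)) (rule ball)
  qed (rule w(1))
qed

text \<open>The balls of \<open>W3_approx\<close> over a tail of the series form the cover,
  \<open>length w\<close> of them for each word \<open>w\<close>. Two degenerate cases are split
  off, a one-point \<open>X\<close> and \<open>s = 0\<close>; in both the set is empty.\<close>

lemma W3_null:
  assumes g: "\<forall>n\<ge>1. 0 \<le> g n" and s: "0 \<le> s"
    and fin: "(\<Sum>n. \<Sum>w | length w = Suc n.
       ennreal (real (Suc n) * (diameter (cylinder t q w) * g (Suc n)) powr s)) < \<infinity>"
  shows "hausdorff_measure s (W3 t q g) = 0"
proof (cases "diameter X = 0")
  case True
  have "finite X"
  proof -
    obtain x where x: "x \<in> X" using X_nonempty by auto
    have "y = x" if "y \<in> X" for y
      using diameter_bounded_bound[OF bounded_X x that] True by simp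
    then have "X \<subseteq> {x}" by auto
    then show ?thesis by (rule finite_subset) simp
  qed
  then have "finite (rational_points t q)" by (simp add: rational_points_def)
  then have "W3 t q g = {}" by (auto simp: W3_def)
  then show ?thesis by (simp add: hausdorff_measure_empty)
next
  case False
  then have D: "0 < diameter X" using diameter_X_nonneg by simp
  define b where "b n = (\<Sum>w | length w = Suc n. real (Suc n) * (diameter (cylinder t q w) * g (Suc n)) powr s)" for n
  have b0: "0 \<le> b n" for n unfolding b_def by (intro sum_nonneg) auto
  have "(\<Sum>n. ennreal (b n)) \<noteq> top"
    using fin by (simp add: b_def sum_ennreal less_top)
  then have sb: "summable b" using summable_iff_suminf_neq_top[of b] b0 by blast
  have cyl: "diameter (cylinder t q w) = ratio w * diameter X" for w by (rule diameter_cylinder)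
  show ?thesis
  proof (cases "s = 0")
    case True
    have "b \<longlonglongrightarrow> 0" using sb by (rule summable_LIMSEQ_zero)
    then have "\<forall>\<^sub>F n in sequentially. b n < 1" by (rule order_tendstoD) simp
    \<comment> \<open>For \<open>s = 0\<close> a single word with positive \<open>g\<close> already
      makes \<open>b\<close> at least 1, since a positive base has power 1.\<close>
    then obtain N where N: "\<And>n. N \<le> n \<Longrightarrow> b n < 1" by (auto simp: eventually_sequentially)
    have "W3 t q g = {}"
    proof (rule ccontr)
      assume "W3 t q g \<noteq> {}"
      then obtain x where x: "x \<in> W3 t q g" by auto
      obtain k l and w :: "'a list" where "l < length w" and w: "length w = Suc (k + N)" "0 < g (length w)"
        and "x \<in> ball (code (periodize l (length w) (nth w))) (2 * g (length w) * ratio w)"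
        using W3_approx[OF g x] .
      have "1 \<le> real (Suc (k + N)) * (diameter (cylinder t q w) * g (Suc (k + N))) powr s"
        using True w D ratio_pos[of w] by (simp add: cyl)
      also have "\<dots> \<le> b (k + N)"
        unfolding b_def using w finite_lists_length[where 'a = 'a]
        by (intro member_le_sum[of w "{w. length w = Suc (k + N)}" "\<lambda>w. real (Suc (k + N)) * (diameter (cylinder t q w) * g (Suc (k + N))) powr s"]) auto
      finally show False using N[of "k + N"] by simp
    qed
    then show ?thesis by (simp add: hausdorff_measure_empty)
  next
    case False
    then have s: "0 < s" using s by simp
    \<comment> \<open>A ball of radius \<open>2 * g (length w) * ratio w\<close> has diameter at
      most twice that, and \<open>ratio w\<close> is the diameter of the cylinder divided by
      \<open>diameter X\<close>.\<close>
    define K where "K = (4 / diameter X) powr s"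
    have K: "0 < K" using D by (simp add: K_def)
    show ?thesis
    proof (rule hausdorff_measure_eq_0I)
      fix \<delta> e :: real assume \<delta>: "0 < \<delta>" and e: "0 < e"
      \<comment> \<open>A tail below \<open>e\<close> controls the total weight; a tail below
        \<open>\<delta> powr s\<close> controls each single ball, hence its diameter.\<close>
      define \<eta> where "\<eta> = min e (\<delta> powr s)"
      have \<eta>: "0 < \<eta>" using e \<delta> by (simp add: \<eta>_def)
      obtain N where "norm (\<Sum>i. b (i + N)) < \<eta> / K"
        using suminf_exist_split[OF _ sb, of "\<eta> / K"] \<eta> K by auto
      then have tail: "K * (\<Sum>i. b (i + N)) \<le> \<eta>" using K by (simp add: field_simps abs_less_iff)
      have sN: "summable (\<lambda>i. b (i + N))" using sb by (simp add: summable_iff_shift)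
      define rad where "rad w = 2 * g (length w) * ratio w" for w
      have rad0: "0 \<le> rad w" if "w \<noteq> []" for w
        using g that ratio_pos[of w] by (auto simp: rad_def Suc_le_eq)
      have rad: "(2 * rad w) powr s = K * (diameter (cylinder t q w) * g (length w)) powr s" if "w \<noteq> []" for w
      proof -
        have "2 * rad w = 4 / diameter X * (diameter (cylinder t q w) * g (length w))"
          using D by (simp add: rad_def cyl)
        moreover have "0 \<le> g (length w)" using g that by (simp add: Suc_le_eq)
        ultimately show ?thesis
          using D ratio_pos[of w] by (simp only: K_def) (intro powr_mult; simp add: cyl)
      qed
      have level: "(\<Sum>w | length w = Suc (k + N). \<Sum>l<Suc (k + N). (2 * rad w) powr s) = K * b (k + N)" for k
        unfolding b_def sum_distrib_left
      proof (rule sum.cong[OF refl])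
        fix w :: "'a list" assume "w \<in> {w. length w = Suc (k + N)}"
        then have w: "length w = Suc (k + N)" "w \<noteq> []" by auto
        show "(\<Sum>l<Suc (k + N). (2 * rad w) powr s) = K * (real (Suc (k + N)) * (diameter (cylinder t q w) * g (Suc (k + N))) powr s)"
          unfolding rad[OF w(2)] w(1) by (simp add: mult_ac)
      qed
      \<comment> \<open>Triples that do not fit get the empty set, so that the index set is a whole
        countable type; \<open>l < length w\<close> supplies the factor \<open>Suc (k + N)\<close>
        in \<open>level\<close>.\<close>
      define U where "U = (\<lambda>(k, w, l). if length w = Suc (k + N) \<and> l < length w
        then ball (code (periodize l (length w) (nth w))) (rad w) else {})"
      have Uball: "hausdorff_weight s (U (k, w, l)) \<le> (if length w = Suc (k + N) \<and> l < length w then ennreal ((2 * rad w) powr s) else 0)" for k w l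
        using hausdorff_weight_ball_le[OF s rad0[of w]] by (auto simp: U_def hausdorff_weight_def)
      obtain V :: "nat \<Rightarrow> (real ^ 'd) set" where V: "(\<Union>i. V i) = (\<Union>i. U i)" "\<And>i. V i = {} \<or> V i \<in> range U"
        "(\<Sum>i. hausdorff_weight s (V i)) = (\<integral>\<^sup>+i. hausdorff_weight s (U i) \<partial>count_space UNIV)"
        by (rule countable_cover_sequence[of U s]) blast
      have "W3 t q g \<subseteq> (\<Union>i. U i)"
      proof
        fix x assume x: "x \<in> W3 t q g"
        obtain k l and w :: "'a list" where "l < length w" "length w = Suc (k + N)" "0 < g (length w)"
          "x \<in> ball (code (periodize l (length w) (nth w))) (2 * g (length w) * ratio w)"
          using W3_approx[OF g x] .
        then show "x \<in> (\<Union>i. U i)" by (intro UN_I[of "(k, w, l)"]) (auto simp: U_def rad_def)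
      qed
      moreover have "bounded (V i) \<and> diameter (V i) \<le> \<delta>" for i
      proof (cases "V i = {}")
        case True
        then show ?thesis using \<delta> by simp
      next
        case False
        then obtain k w l where "V i = U (k, w, l)" using V(2)[of i] by auto
        then have Vi: "V i = ball (code (periodize l (length w) (nth w))) (rad w)" and w: "length w = Suc (k + N)" "w \<noteq> []" "l < length w"
          using False by (auto simp: U_def split: if_splits)
        have "(2 * rad w) powr s \<le> (\<Sum>l<Suc (k + N). (2 * rad w) powr s)"
          by (rule member_le_sum[of 0 "{..<Suc (k + N)}" "\<lambda>_. (2 * rad w) powr s"]) auto
        also have "\<dots> \<le> (\<Sum>w | length w = Suc (k + N). \<Sum>l<Suc (k + N). (2 * rad w) powr s)"
          using w finite_lists_length[where 'a = 'a]
          by (intro member_le_sum[of w "{w. length w = Suc (k + N)}" "\<lambda>w. \<Sum>l<Suc (k + N). (2 * rad w) powr s"]) (auto intro!: sum_nonneg)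
        also have "\<dots> = K * b (k + N)" by (rule level)
        also have "b (k + N) \<le> (\<Sum>i. b (i + N))" using sum_le_suminf[OF sN, of "{k}"] b0 by simp
        also have "K * (\<Sum>i. b (i + N)) \<le> \<delta> powr s" using tail by (simp add: \<eta>_def)
        finally have "(2 * rad w) powr s \<le> \<delta> powr s" using K by simp
        then have "2 * rad w \<le> \<delta>"
          using powr_less_mono2[of s \<delta> "2 * rad w"] s \<delta> by (meson less_imp_le not_le)
        moreover have "diameter (ball (code (periodize l (length w) (nth w))) (rad w)) \<le> 2 * rad w"
        proof (rule diameter_le)
          fix y z assume "y \<in> ball (code (periodize l (length w) (nth w))) (rad w)" "z \<in> ball (code (periodize l (length w) (nth w))) (rad w)"
          then show "norm (y - z) \<le> 2 * rad w"
            using dist_triangle[of y z "code (periodize l (length w) (nth w))"] by (simp add: dist_norm[symmetric] dist_commute)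
        qed (use rad0[OF w(2)] in auto)
        ultimately show ?thesis unfolding Vi by auto
      qed
      moreover have "(\<Sum>i. hausdorff_weight s (V i)) \<le> ennreal e"
      proof -
        have "(\<Sum>i. hausdorff_weight s (V i)) = (\<integral>\<^sup>+k. \<integral>\<^sup>+(w, l). hausdorff_weight s (U (k, w, l)) \<partial>count_space UNIV \<partial>count_space UNIV)"
          unfolding V(3) by (subst nn_integral_fst_count_space[symmetric]) (simp add: case_prod_unfold)
        also have "\<dots> \<le> (\<integral>\<^sup>+k. ennreal (K * b (k + N)) \<partial>count_space UNIV)"
        proof (rule nn_integral_mono)
          fix k
          let ?A = "{w :: 'a list. length w = Suc (k + N)} \<times> {..<Suc (k + N)}"
          have "(\<integral>\<^sup>+(w, l). hausdorff_weight s (U (k, w, l)) \<partial>count_space UNIV)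
            \<le> (\<integral>\<^sup>+(w, l). (if length w = Suc (k + N) \<and> l < length w then ennreal ((2 * rad w) powr s) else 0) \<partial>count_space UNIV)"
            using Uball by (intro nn_integral_mono) auto
          also have "\<dots> = (\<Sum>(w, l)\<in>?A. if length w = Suc (k + N) \<and> l < length w then ennreal ((2 * rad w) powr s) else 0)"
            by (rule nn_integral_count_space') (auto simp: finite_lists_length split: if_splits)
          also have "\<dots> = (\<Sum>w | length w = Suc (k + N). \<Sum>l<Suc (k + N). ennreal ((2 * rad w) powr s))"
            unfolding sum.cartesian_product by (intro sum.cong) auto
          also have "\<dots> = ennreal (K * b (k + N))"
            unfolding level[symmetric] by (simp only: sum_ennreal sum_nonneg powr_ge_zero)
          finally show "(\<integral>\<^sup>+(w, l). hausdorff_weight s (U (k, w, l)) \<partial>count_space UNIV) \<le> ennreal (K * b (k + N))" .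
        qed
        also have "\<dots> = (\<Sum>k. ennreal (K * b (k + N)))" by (rule nn_integral_count_space_nat)
        also have "\<dots> = ennreal (\<Sum>k. K * b (k + N))"
          using K b0 sN by (intro suminf_ennreal2 summable_mult) auto
        also have "\<dots> = ennreal (K * (\<Sum>k. b (k + N)))" by (simp add: suminf_mult[OF sN])
        also have "\<dots> \<le> ennreal e" using tail by (intro ennreal_leI) (simp add: \<eta>_def)
        finally show ?thesis .
      qed
      ultimately show "\<exists>U :: nat \<Rightarrow> (real ^ 'd) set. W3 t q g \<subseteq> (\<Union>i. U i)
        \<and> (\<forall>i. bounded (U i) \<and> diameter (U i) \<le> \<delta>) \<and> (\<Sum>i. hausdorff_weight s (U i)) \<le> ennreal e"
        using V(1) by (intro exI[of _ V]) auto
    qed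
  qed
qed

end

section \<open>Divergence\<close>

context letter_weights
begin

lemma prob_singleton:
  assumes "\<And>a. p a < 1"
  shows "{w} \<in> null_sets iid"
proof -
  have eq: "{w} = (\<Inter>n. {z. \<forall>c\<in>{..<n}. z c = w c})"
    by (auto simp: fun_eq_iff)
  have meas: "{w} \<in> sets iid"
    by (subst eq) (auto intro!: sets.countable_INT sets_iid_word simp del: lessThan_iff)
  define r where "r = Max (range p)"
  have r: "p a \<le> r" "r < 1" for a using assms by (auto simp: r_def)
  have r0: "0 \<le> r" using r(1)[of undefined] p_pos[of undefined] by linarith
  have "iid.prob {w} \<le> r ^ n" for n
  proof -
    have "iid.prob {w} \<le> iid.prob {z. \<forall>c\<in>{..<n}. z c = w c}"
      by (intro iid.finite_measure_mono sets_iid_word) auto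
    also have "\<dots> = wt w 0 n" by (subst prob_word) (simp_all add: wt_def)
    also have "\<dots> \<le> r ^ n" by (rule wt_le_power[OF r(1)])
    finally show ?thesis .
  qed
  moreover have "(\<lambda>n. r ^ n) \<longlonglongrightarrow> 0" using r r0 by (intro LIMSEQ_power_zero) simp
  ultimately have "iid.prob {w} \<le> 0" by (intro LIMSEQ_le_const[of "\<lambda>n. r ^ n"]) auto
  then show ?thesis using meas by (simp add: null_sets_def iid.emeasure_eq_measure order_antisym)
qed

lemma AE_not_in_countable:
  assumes "\<And>a. p a < 1" "countable S"
  shows "AE z in iid. z \<notin> S"
proof (rule AE_not_in)
  have "(\<Union>w\<in>S. {w}) \<in> null_sets iid" using assms by (intro null_sets_UN' prob_singleton)
  then show "S \<in> null_sets iid" by simp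
qed

lemma measurable_letter [measurable]: "(\<lambda>z. z c) \<in> measurable iid (count_space UNIV)"
proof (rule measurableI)
  fix A :: "'a set"
  have "(\<lambda>z. z c) -` A \<inter> space iid = (\<Union>a\<in>A. {z. z c = a})" by auto
  also have "\<dots> \<in> sets iid" by (intro sets.finite_UN sets_iid_coord) auto
  finally show "(\<lambda>z. z c) -` A \<inter> space iid \<in> sets iid" .
qed auto

end

lemma sum_prod_list_length:
  fixes h :: "'a::finite \<Rightarrow> real"
  shows "(\<Sum>w | length w = n. \<Prod>a\<leftarrow>w. h a) = (\<Sum>a\<in>UNIV. h a) ^ n"
proof (induction n)
  case (Suc n)
  have "{w :: 'a list. length w = Suc n} = (\<lambda>(a, w). a # w) ` (UNIV \<times> {w. length w = n})"
    by (auto simp: length_Suc_conv image_def)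
  then have "(\<Sum>w | length w = Suc n. \<Prod>a\<leftarrow>w. h a) = (\<Sum>(a, w)\<in>UNIV \<times> {w. length w = n}. h a * (\<Prod>a\<leftarrow>w. h a))"
    by (simp add: sum.reindex inj_on_def case_prod_unfold)
  also have "\<dots> = (\<Sum>a\<in>UNIV. h a) * (\<Sum>w | length w = n. \<Prod>a\<leftarrow>w. h a)"
    by (simp add: sum.cartesian_product[symmetric] sum_product)
  finally show ?case using Suc by simp
qed simp

text \<open>The sum is strictly decreasing in the exponent, equals \<open>CARD('a) \<ge> 2\<close>
  at 0 and is at most \<open>n / 2 ^ n \<le> 1\<close> at \<open>n = CARD('a)\<close>, so the
  intermediate value theorem and monotonicity justify \<open>THE\<close>. Two distinct letters make
  the root positive.\<close>

lemma sim_dim_sum: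
  fixes q :: "'a::finite \<Rightarrow> int"
  assumes q: "\<And>a. 2 \<le> \<bar>q a\<bar>" and ab: "a \<noteq> (b :: 'a)"
  shows "(\<Sum>a\<in>UNIV. (1 / real_of_int \<bar>q a\<bar>) powr sim_dim q) = 1" and "0 < sim_dim q"
proof -
  define \<Phi> where "\<Phi> s = (\<Sum>a\<in>UNIV. (1 / real_of_int \<bar>q a\<bar>) powr s)" for s
  have r: "0 < 1 / real_of_int \<bar>q a\<bar>" "1 / real_of_int \<bar>q a\<bar> < 1" "1 / real_of_int \<bar>q a\<bar> \<le> 1 / 2" for a
    using q[of a] by (auto simp: field_simps)
  have q0: "q a \<noteq> 0" for a using q[of a] by auto
  have mono: "\<Phi> y < \<Phi> x" if "x < y" for x y
    unfolding \<Phi>_def using r that by (intro sum_strict_mono powr_less_mono') auto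
  have card: "2 \<le> CARD('a)" using card_mono[of UNIV "{a, b}"] ab by simp
  have \<Phi>0: "\<Phi> 0 = real CARD('a)" by (simp add: \<Phi>_def q0)
  have "\<Phi> (real CARD('a)) \<le> 1"
  proof -
    have "\<Phi> (real CARD('a)) \<le> (\<Sum>a\<in>(UNIV :: 'a set). (1 / 2) powr real CARD('a))"
      unfolding \<Phi>_def by (intro sum_mono powr_mono2 r(3) less_imp_le[OF r(1)]) simp
    also have "\<dots> = real CARD('a) * (1 / 2) ^ CARD('a)" by (simp add: powr_realpow)
    also have "\<dots> \<le> 2 ^ CARD('a) * (1 / 2) ^ CARD('a)"
      by (intro mult_right_mono) (simp_all add: of_nat_less_two_power less_imp_le)
    also have "\<dots> = 1" by (simp add: power_mult_distrib[symmetric])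
    finally show ?thesis .
  qed
  moreover have "continuous_on {0..real CARD('a)} \<Phi>"
    unfolding \<Phi>_def by (intro continuous_intros) (simp add: q0)
  ultimately obtain s where s: "\<Phi> s = 1"
    using IVT2'[of \<Phi> "real CARD('a)" 1 0] \<Phi>0 card by auto
  have "sim_dim q = s"
    unfolding sim_dim_def \<Phi>_def[symmetric]
  proof (rule the_equality[where P = "\<lambda>s. \<Phi> s = 1"])
    fix y assume "\<Phi> y = 1"
    then show "y = s" using mono[of y s] mono[of s y] s by (cases y s rule: linorder_cases) auto
  qed (fact s)
  then show "(\<Sum>a\<in>UNIV. (1 / real_of_int \<bar>q a\<bar>) powr sim_dim q) = 1" using s by (simp add: \<Phi>_def)
  have "0 < s"
  proof (rule ccontr)
    assume "\<not> 0 < s"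
    then have "\<Phi> 0 \<le> \<Phi> s" using mono[of s 0] by (cases "s = 0") auto
    then show False using s \<Phi>0 card by simp
  qed
  then show "0 < sim_dim q" using \<open>sim_dim q = s\<close> by simp
qed

section \<open>Full measure of the limsup set when the series diverges\<close>

context separated_ifs
begin

text \<open>The rational points are countable; once they are enumerated, infinitely many
  approximations means a limit superior of balls.\<close>

lemma sets_W3: "W3 t q g \<in> sets borel"
proof -
  define Q where "Q = rational_points t q"
  have Q: "countable Q" unfolding Q_def by (rule countable_rational_points)
  let ?P = "\<lambda>r x. norm (x - r) < g (n_int t q r) / q_int t q r"
  have inf: "infinite {r \<in> Q. ?P r x} \<longleftrightarrow> (\<forall>n. \<exists>r\<in>{r \<in> Q. n \<le> to_nat_on Q r}. ?P r x)" for x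
  proof -
    have "finite {r \<in> Q. ?P r x} \<longleftrightarrow> finite (to_nat_on Q ` {r \<in> Q. ?P r x})"
      using inj_on_subset[OF inj_on_to_nat_on[OF Q]] by (intro finite_image_iff[symmetric]) auto
    then have "infinite {r \<in> Q. ?P r x} \<longleftrightarrow> (\<forall>n. \<exists>m\<ge>n. m \<in> to_nat_on Q ` {r \<in> Q. ?P r x})"
      by (simp only: infinite_nat_iff_unbounded_le)
    also have "\<dots> \<longleftrightarrow> (\<forall>n. \<exists>r\<in>{r \<in> Q. n \<le> to_nat_on Q r}. ?P r x)" by blast
    finally show ?thesis .
  qed
  have "W3 t q g = X \<inter> (\<Inter>n. \<Union>r\<in>{r \<in> Q. n \<le> to_nat_on Q r}. {x. ?P r x})"
    unfolding W3_def Q_def[symmetric] inf by auto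
  also have "\<dots> \<in> sets borel"
  proof (intro sets.Int sets.countable_INT sets.countable_UN' image_subsetI)
    show "X \<in> sets borel" using compact_range_code by (simp add: X_eq borel_compact)
    show "countable {r \<in> Q. n \<le> to_nat_on Q r}" for n using Q by (rule countable_subset[rotated]) auto
    fix n r
    have "{x. ?P r x} = ball r (g (n_int t q r) / q_int t q r)" by (auto simp: dist_norm norm_minus_commute)
    then show "{x. ?P r x} \<in> sets borel" by simp
  qed auto
  finally show ?thesis .
qed

lemma two_letters:
  assumes "0 < diameter X"
  obtains a b :: 'a where "a \<noteq> b"
proof (rule ccontr)
  assume "\<not> thesis"
  then have eq: "\<And>a b :: 'a. a = b" using that by blast
  have "code \<omega> = code (\<lambda>_. undefined)" for \<omega>
    by (rule arg_cong[where f = code], rule ext) (rule eq)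
  then have "X = {code (\<lambda>_. undefined)}" unfolding X_eq by auto
  then show False using assms by simp
qed

text \<open>A repetition makes the coded point share \<open>n + m\<close> letters with the coding
  \<open>periodize l n z\<close>, so the distance is at most the ratio of the first \<open>n\<close>
  letters, times that of the copied word, times \<open>D\<close>. The first factor is matched by
  \<open>1 / q_int t q r\<close>, and the second is small because its weight is at most
  \<open>G (8 ^ Suc k)\<close>.\<close>

lemma W3_full:
  assumes g: "\<forall>n\<ge>1. 0 \<le> g n" and anti: "antimono_on {1..} g"
    and div: "(\<Sum>n. \<Sum>w | length w = Suc n.
       ennreal (real (Suc n) * (diameter (cylinder t q w) * g (Suc n)) powr sim_dim q)) = \<infinity>"
  shows "emeasure (self_similar_measure t q) (W3 t q g) = 1"
proof -
  define D where "D = diameter X"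
  define s where "s = sim_dim q"
  \<comment> \<open>\<open>0 powr s\<close> is 0 for every \<open>s\<close>, so a one-point
    \<open>X\<close> would make all terms vanish.\<close>
  have D: "0 < D"
  proof (rule ccontr)
    assume "\<not> 0 < D"
    then have "diameter X = 0" using diameter_X_nonneg by (simp add: D_def)
    then show False using div by (simp add: diameter_cylinder)
  qed
  obtain a0 b0 :: 'a where ab: "a0 \<noteq> b0" using two_letters D unfolding D_def by blast
  have s: "(\<Sum>a\<in>UNIV. (1 / real_of_int \<bar>q a\<bar>) powr s) = 1" "0 < s"
    unfolding s_def using sim_dim_sum[OF q_ge_2 ab] by auto
  have r: "0 < 1 / real_of_int \<bar>q a\<bar>" "1 / real_of_int \<bar>q a\<bar> < 1" for a
    using q_ge_2[of a] by (auto simp: field_simps)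
  have p: "prob_vec q a = (1 / real_of_int \<bar>q a\<bar>) powr s" for a by (simp add: prob_vec_def s_def)
  interpret letter_weights "prob_vec q"
  proof unfold_locales
    show "0 < prob_vec q a" for a using r(1)[of a] by (simp add: p)
    show "(\<Sum>a\<in>UNIV. prob_vec q a) = 1" unfolding p by (rule s(1))
  qed
  have iid: "bernoulli_measure q = iid" by (simp add: bernoulli_measure_def iid_def)
  have p1: "prob_vec q a < 1" for a
    using powr_less_mono2[of s "1 / real_of_int \<bar>q a\<bar>" 1] r[of a] s by (simp add: p)
  have ratio_powr: "(\<Prod>a\<leftarrow>w. prob_vec q a) = ratio w powr s" for w
    by (induction w) (simp_all add: p powr_mult[symmetric] less_imp_le[OF ratio_pos] mult.commute powr_divide)
  \<comment> \<open>The denominator is chosen so that \<open>D / (2 * D + 2) < 2 / 3\<close>, which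
    beats the constant \<open>3 / 2\<close> of \<open>q_int_le\<close> strictly.\<close>
  define G where "G n = (g n / (2 * D + 2)) powr s" for n
  have AE1: "AE z in iid. infinite {k. \<exists>l n m. 8 ^ k \<le> l \<and> l < n \<and> l + m \<le> n \<and> n \<le> 8 ^ Suc k \<and> 0 < G (8 ^ Suc k)
    \<and> wt z l m \<le> G (8 ^ Suc k) \<and> (\<forall>a<m. z (n + a) = z (l + a))}"
  proof (rule AE_infinitely_many_repetitions[OF p1])
    show "0 \<le> G n" for n by (simp add: G_def)
    show "G n \<le> G m" if "1 \<le> m" "m \<le> n" for m n
      unfolding G_def using anti that g s D
      by (intro powr_mono2 divide_right_mono) (auto simp: monotone_on_def)
    show "\<not> summable (\<lambda>n. real n * G n)"
    proof
      assume "summable (\<lambda>n. real n * G n)"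
      then have "summable (\<lambda>n. real (Suc n) * G (Suc n))" by (subst summable_Suc_iff)
      then have sm: "summable (\<lambda>n. (D * (2 * D + 2)) powr s * (real (Suc n) * G (Suc n)))" by (rule summable_mult)
      \<comment> \<open>The Bernoulli weights of the words of length \<open>Suc n\<close> add up to
        1, so the double series is a constant times the series of \<open>n * G n\<close>.\<close>
      have "(\<Sum>w | length w = Suc n. ennreal (real (Suc n) * (diameter (cylinder t q w) * g (Suc n)) powr s))
        = ennreal ((D * (2 * D + 2)) powr s * (real (Suc n) * G (Suc n)))" for n
      proof -
        have "(diameter (cylinder t q w) * g (Suc n)) powr s = (D * (2 * D + 2)) powr s * G (Suc n) * ratio w powr s" for w
        proof -
          have "diameter (cylinder t q w) * g (Suc n) = (D * (2 * D + 2)) * (g (Suc n) / (2 * D + 2)) * ratio w"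
            using D by (simp add: diameter_cylinder D_def[symmetric] field_simps)
          then show ?thesis by (simp only: G_def powr_mult)
        qed
        then have "(\<Sum>w | length w = Suc n. ennreal (real (Suc n) * (diameter (cylinder t q w) * g (Suc n)) powr s))
          = ennreal (\<Sum>w | length w = Suc n. (D * (2 * D + 2)) powr s * (real (Suc n) * G (Suc n)) * ratio w powr s)"
          by (simp only: mult_ac) (intro sum_ennreal, simp add: G_def)
        also have "(\<Sum>w | length w = Suc n. (D * (2 * D + 2)) powr s * (real (Suc n) * G (Suc n)) * ratio w powr s)
          = (D * (2 * D + 2)) powr s * (real (Suc n) * G (Suc n)) * (\<Sum>w | length w = Suc n. \<Prod>a\<leftarrow>w. prob_vec q a)"
          unfolding ratio_powr by (rule sum_distrib_left[symmetric])
        also have "(\<Sum>w | length w = Suc n. \<Prod>a\<leftarrow>w. prob_vec q a) = 1"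
          unfolding sum_prod_list_length by (simp add: p_sum)
        finally show ?thesis by simp
      qed
      then have "(\<Sum>n. ennreal ((D * (2 * D + 2)) powr s * (real (Suc n) * G (Suc n)))) = \<infinity>"
        using div unfolding s_def[symmetric] by simp
      moreover have "(\<Sum>n. ennreal ((D * (2 * D + 2)) powr s * (real (Suc n) * G (Suc n)))) \<noteq> \<infinity>"
        by (subst suminf_ennreal2[OF _ sm]) (simp_all add: G_def)
      ultimately show False by blast
    qed
  qed
  \<comment> \<open>Rational coded points must be avoided: below, infinitely many approximations
    come from distances that are ever smaller but positive.\<close>
  have "AE z in iid. z \<notin> code -` rational_points t q"
  proof (intro AE_not_in_countable p1)
    have "countable (code ` (code -` rational_points t q))"
      by (rule countable_subset[OF _ countable_rational_points]) auto
    then show "countable (code -` rational_points t q)"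
      by (rule countable_image_inj_on) (rule inj_on_subset[OF inj_code], simp)
  qed
  with AE1 have AE2: "AE z in iid. code z \<in> W3 t q g"
  proof eventually_elim
    case (elim z)
    let ?R = "{r \<in> rational_points t q. norm (code z - r) < g (n_int t q r) / q_int t q r}"
    have near: "\<exists>r\<in>?R. dist (code z) r \<le> D * (1 / 2) ^ k"
      if k: "k \<in> {k. \<exists>l n m. 8 ^ k \<le> l \<and> l < n \<and> l + m \<le> n \<and> n \<le> 8 ^ Suc k \<and> 0 < G (8 ^ Suc k)
      \<and> wt z l m \<le> G (8 ^ Suc k) \<and> (\<forall>a<m. z (n + a) = z (l + a))}" for k
    proof -
      obtain l n m where lnm: "8 ^ k \<le> l" "l < n" "l + m \<le> n" "n \<le> 8 ^ Suc k" "0 < G (8 ^ Suc k)"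
        "wt z l m \<le> G (8 ^ Suc k)" "\<And>a. a < m \<Longrightarrow> z (n + a) = z (l + a)" using k by blast
      define \<gamma> where "\<gamma> = g (8 ^ Suc k)"
      have "\<gamma> \<noteq> 0" using lnm(5) by (auto simp: G_def \<gamma>_def)
      then have \<gamma>: "0 < \<gamma>" using g by (simp add: \<gamma>_def order_less_le)
      define r where "r = code (periodize l n z)"
      have rat: "r \<in> rational_points t q" unfolding r_def by (rule code_periodize_rational[OF lnm(2)])
      have rX: "r \<in> X" using rat by (simp add: rational_points_def)
      have cod: "coding t q r = periodize l n z" by (simp add: r_def)
      have per: "coding t q r = periodize l n (coding t q r)" unfolding cod by (rule periodize_idem[OF lnm(2), symmetric])
      define \<rho> where "\<rho> = ratio (map z [0..<n])"
      have \<rho>: "0 < \<rho>" unfolding \<rho>_def by (rule ratio_pos)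
      define w where "w = map (\<lambda>a. z (l + a)) [0..<m]"
      \<comment> \<open>The first \<open>n\<close> letters agree by construction, the next
        \<open>m\<close> by the repetition; \<open>l + m \<le> n\<close> keeps the latter within one
        period.\<close>
      have agree: "z j = periodize l n z j" if "j < n + m" for j
      proof (cases "j < n")
        case False
        define a where "a = j - n"
        have a: "j = n + a" "a < m" using False that by (auto simp: a_def)
        have "j - l = a + (n - l)" "a < n - l" using a lnm(2,3) by auto
        then have "(j - l) mod (n - l) = a" by (simp only: mod_add_self2 mod_less)
        then have "periodize l n z j = z (l + a)" using a(1) lnm(2) by (simp add: periodize_def)
        then show ?thesis using a lnm(7)[OF a(2)] by simp
      qed (simp add: periodize_prefix)
      have "map z [0..<n + m] = map z [0..<n] @ w"
      proof -
        have "map z [n..<n + m] = w"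
          unfolding w_def by (rule nth_equalityI) (auto simp: lnm(7))
        moreover have "[0..<n + m] = [0..<n] @ [n..<n + m]" by (rule upt_add_eq_append) simp
        ultimately show ?thesis by (simp only: map_append)
      qed
      then have d: "dist (code z) r \<le> \<rho> * ratio w * D"
        using dist_code_le[of "n + m" z "periodize l n z"] agree by (simp add: r_def \<rho>_def D_def)
      have "ratio w powr s = wt z l m"
        unfolding ratio_powr[symmetric] w_def by (induction m) (simp_all add: wt_Suc)
      then have "ratio w powr s \<le> (\<gamma> / (2 * D + 2)) powr s" using lnm(6) by (simp add: G_def \<gamma>_def)
      then have ratio_w: "ratio w \<le> \<gamma> / (2 * D + 2)"
        using powr_less_mono2[of s "\<gamma> / (2 * D + 2)" "ratio w"] s \<gamma> D by (fastforce simp: not_le[symmetric])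
      have "\<rho> * ratio w * D \<le> \<rho> * (\<gamma> / (2 * D + 2)) * D"
        using ratio_w \<rho> D by (intro mult_right_mono mult_left_mono) auto
      also have "\<dots> < \<gamma> / (3 / 2 * (1 / \<rho>))"
      proof -
        have "D / (2 * D + 2) < 2 / 3" using D by (simp add: field_simps)
        then have "\<rho> * \<gamma> * (D / (2 * D + 2)) < \<rho> * \<gamma> * (2 / 3)"
          using \<rho> \<gamma> by (intro mult_strict_left_mono) auto
        then show ?thesis using \<rho> by (simp add: mult_ac)
      qed
      also have "1 / \<rho> = (\<Prod>j<n. real_of_int \<bar>q (coding t q r j)\<bar>)"
        unfolding \<rho>_def ratio_map_upt cod by (simp add: periodize_prefix)
      also have "\<gamma> / (3 / 2 * (\<Prod>j<n. real_of_int \<bar>q (coding t q r j)\<bar>)) \<le> \<gamma> / q_int t q r"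
        using \<gamma> q_int_pos[OF rat] by (intro divide_left_mono q_int_le[OF rX lnm(2) per]) (auto intro!: mult_pos_pos prod_pos)
      also have "\<dots> \<le> g (n_int t q r) / q_int t q r"
      proof (rule divide_right_mono)
        \<comment> \<open>\<open>g\<close> is antimonotone from 1 on only, so
          \<open>n_int t q r \<ge> 1\<close> is needed besides the upper bound
          \<open>8 ^ Suc k\<close>.\<close>
        obtain l' where "l' < n_int t q r" using n_int_attained[OF rat] by blast
        then have "1 \<le> n_int t q r" by simp
        moreover have "n_int t q r \<le> 8 ^ Suc k" using n_int_le[OF rX lnm(2) per] lnm(4) by simp
        ultimately show "\<gamma> \<le> g (n_int t q r)" using anti unfolding \<gamma>_def monotone_on_def by simp
      qed (use q_int_pos[OF rat] in simp)
      finally have "r \<in> ?R" using rat d by (simp add: dist_norm)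
      moreover have "dist (code z) r \<le> D * (1 / 2) ^ k"
      proof -
        have "k \<le> 8 ^ k" by (rule less_imp_le, rule less_le_trans[OF less_exp], rule power_mono) auto
        then have "k \<le> n" using lnm by linarith
        have "dist (code z) r \<le> \<rho> * D"
          using dist_code_le[of n z "periodize l n z"] agree by (simp add: r_def \<rho>_def D_def)
        also have "\<dots> \<le> (1 / 2) ^ n * D"
          using ratio_le[of "map z [0..<n]"] D by (intro mult_right_mono) (auto simp: \<rho>_def)
        also have "\<dots> \<le> (1 / 2) ^ k * D"
          using \<open>k \<le> n\<close> D by (intro mult_right_mono power_decreasing) auto
        finally show ?thesis by (simp add: mult.commute)
      qed
      ultimately show ?thesis by blast
    qed
    \<comment> \<open>Different \<open>k\<close> could yield the same rational point. But finitely
      many points other than \<open>code z\<close> keep a positive distance from it, while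
      \<open>near\<close> offers distances of at most \<open>D * (1 / 2) ^ k\<close>.\<close>
    have "infinite ?R"
    proof
      assume "finite ?R"
      then obtain e where e: "0 < e" "\<And>r. r \<in> ?R \<Longrightarrow> r \<noteq> code z \<Longrightarrow> e \<le> dist (code z) r"
        using finite_set_avoid[of ?R "code z"] by blast
      obtain k0 where k0: "(1 / 2 :: real) ^ k0 < e / D" using real_arch_pow_inv[of "e / D" "1 / 2"] e D by auto
      obtain k where k: "k0 \<le> k" "k \<in> {k. \<exists>l n m. 8 ^ k \<le> l \<and> l < n \<and> l + m \<le> n \<and> n \<le> 8 ^ Suc k \<and> 0 < G (8 ^ Suc k)
        \<and> wt z l m \<le> G (8 ^ Suc k) \<and> (\<forall>a<m. z (n + a) = z (l + a))}"
        using elim(1) unfolding infinite_nat_iff_unbounded_le by blast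
      obtain r where r: "r \<in> ?R" "dist (code z) r \<le> D * (1 / 2) ^ k" using near[OF k(2)] by blast
      have "r \<noteq> code z" using r(1) elim(2) by auto
      then have "e \<le> D * (1 / 2) ^ k" using e(2)[OF r(1)] r(2) by simp
      also have "\<dots> \<le> D * (1 / 2) ^ k0" using k(1) D by (intro mult_left_mono power_decreasing) auto
      also have "\<dots> < e" using k0 D by (simp add: field_simps)
      finally show False by simp
    qed
    then show ?case by (simp add: W3_def X_eq)
  qed
  have meas: "code \<in> borel_measurable iid"
  proof (rule borel_measurable_LIMSEQ_metric)
    show "(\<lambda>N. \<Sum>n<N. (1 / of_int (\<Prod>j\<le>n. q (z j))) *\<^sub>R transl (z n)) \<longlonglongrightarrow> code z" for z
      unfolding code_eq by (rule summable_LIMSEQ[OF summable_code])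
    have [measurable]: "(\<lambda>z. real_of_int (q (z j))) \<in> borel_measurable iid" "(\<lambda>z. transl (z j)) \<in> borel_measurable iid" for j
      by (rule measurable_compose[OF measurable_letter], simp)+
    show "(\<lambda>z. \<Sum>n<N. (1 / of_int (\<Prod>j\<le>n. q (z j))) *\<^sub>R transl (z n)) \<in> borel_measurable iid" for N
      unfolding of_int_prod by measurable
  qed
  have "emeasure (self_similar_measure t q) (W3 t q g) = emeasure iid (code -` W3 t q g \<inter> space iid)"
    unfolding self_similar_measure_def iid using meas sets_W3 by (rule emeasure_distr)
  also have "\<dots> = 1"
    using AE2 measurable_sets[OF meas sets_W3] by (subst iid.emeasure_eq_1_AE) auto
  finally show ?thesis .
qed

end

theorem theorem2p6:
  fixes t :: "'a::finite \<Rightarrow> int ^ 'd"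
    and q :: "'a \<Rightarrow> int"
    and g :: "nat \<Rightarrow> real"
  assumes "\<forall>a. \<bar>q a\<bar> \<ge> 2"
    and "strong_separation t q"
    and "\<forall>n\<ge>1. g n \<ge> 0"
  shows "(\<forall>s\<ge>0.
            (\<Sum>n. \<Sum>w | length w = Suc n.
               ennreal (real (Suc n) * (diameter (cylinder t q w) * g (Suc n)) powr s)) < \<infinity>
            \<longrightarrow> hausdorff_measure s (W3 t q g) = 0)
       \<and> (antimono_on {1..} g
            \<and> prob_entropy q < - 2 * ln (\<Sum>a\<in>UNIV. (prob_vec q a)\<^sup>2)
            \<and> (\<Sum>n. \<Sum>w | length w = Suc n.
                 ennreal (real (Suc n) * (diameter (cylinder t q w) * g (Suc n)) powr sim_dim q)) = \<infinity>
            \<longrightarrow> emeasure (self_similar_measure t q) (W3 t q g) = 1)"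
proof -
  interpret separated_ifs t q
    using assms by unfold_locales auto
  show ?thesis using W3_null[OF assms(3)] W3_full[OF assms(3)] by blast
qed

end
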